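(* Let $D$ be a $(2^n,2^n,2^n,1)$-relative difference set in $\mathbb{Z}_4^n$ relative to $2\mathbb{Z}_4^n$, let $h:\mathbb{F}_2^n\to\mathbb{F}_2^n$ be its normalized $\mathbb{F}_2^n$-representation, let $*:=*_h$ and $\star$ be as in the context, let $B$ be a basis of $\mathbb{F}_{2^n}$ over $\mathbb{F}_2$ and let $\hat f_B$ be the normalized $\mathbb{F}_{2^n}$-representation of $D$ with respect to $B$, and let $\Pi$ be the projective plane obtained from $D$. Then the following are equivalent: (1) $(\mathbb{F}_2^n,\star,+)$ is a commutative semifield; (2) $(\mathbb{F}_2^n,*,+)$ is a commutative presemifield; (3) $h(x+y+z)+h(x+y)+h(x+z)+h(y+z)+h(x)+h(y)+h(z)=0$ for all $x,y,z\in\mathbb{F}_2^n$; (4) every coordinate (component) function of $h$ has algebraic degree at most $2$; (5) $\hat f_B$ is a Dembowski–Ostrom polynomial, i.e. of the form $\sum_{i,j}c_{ij}x^{2^i+2^j}$ (the zero polynomial included); (6) $\Pi$ is a commutative semifield plane.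
   Context: Relative difference set: a $k$-subset $D$ of a group $G$ of order $mn$, with subgroup $N$ of order $n$, such that every element of $G\setminus N$ is a difference of two elements of $D$ in exactly $\lambda$ ways and no nonzero element of $N$ is; parameters $(m,n,k,\lambda)$. Let $\psi:\mathbb{F}_2\to\mathbb{Z}_4$ be $0\mapsto0,1\mapsto1$, $\Psi$ its coordinatewise extension, $\lfloor a,b\rfloor:=\Psi(a)+2\Psi(b)$ for $a,b\in\mathbb{F}_2^n$. $D$ is a transversal of $N=2\mathbb{Z}_4^n$ and its elements are uniquely $\lfloor d,h(d)\rfloor$; $h$ is the $\mathbb{F}_2^n$-representation, normalized if no coordinate function (as a reduced Boolean polynomial) has linear or constant terms. $x\odot y=(x_iy_i)_i$ and $x*_hy=h(x+y)+h(x)+h(y)+x\odot y$. Let $1$ denote the vector $(0,\dots,0,1)\in\mathbb{F}_2^n$; the map $y\mapsto 1*y$ is a bijection, with inverse $\tau$, and $m\star x:=\tau(m*x)$. For a basis $B=\{\xi_i\}$ of $\mathbb{F}_{2^n}$, identify $\mathbb{F}_{2^n}$ with $\mathbb{F}_2^n$ via coordinates, let $h_B$ be $h$ viewed as a polynomial map on $\mathbb{F}_{2^n}$, $\mu_B(x)=\sum_{i<j}x_ix_j\xi_i\xi_j$, $f_B=h_B^2+\mu_B$, and $\hat f_B$ is $f_B$ with all terms of the form $ux^{2^i}$ and the constant term removed. A presemifield is a ring-like structure $(S,+,* )$ with $(S,+)$ an abelian group, $*$ distributive on both sides, and no zero divisors; a semifield is a presemifield with multiplicative identity. The plane $\Pi$: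 points are the elements of $G=\mathbb{Z}_4^n$ together with points at infinity; lines are the translates $D+g$, the cosets $N+g$, and a line $L_\infty$; the points of $L_\infty$ are one point for each parallel class $\{D+g+t:t\in N\}$ (incident with each line of that class) and a point $(\infty)$ incident with all cosets of $N$ and with $L_\infty$. A commutative semifield plane is a projective plane that can be coordinatized by a commutative semifield. *)

theory Defs
  imports
    "HOL-Library.Z2"
    "HOL-Library.Numeral_Type"
    "HOL-Analysis.Finite_Cartesian_Product"
    "HOL-Computational_Algebra.Polynomial"
    "HOL-Algebra.Group"
begin

text \<open>
  \<open>F\<^sub>2\<close> is the field \<^typ>\<open>bit\<close>, \<open>Z\<^sub>4\<close> the ring \<^typ>\<open>4\<close>, and \<open>n\<close> is the cardinality of the index
  type \<open>'n\<close>. The index type is linearly ordered, because the last coordinate and the sum over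
  \<open>i < j\<close> refer to an order of the coordinates.
\<close>

subsection \<open>Relative difference sets\<close>

definition additive_group :: "'g::group_add monoid" where
  "additive_group = \<lparr>carrier = UNIV, monoid.mult = (+), one = 0\<rparr>"

definition relative_difference_set ::
    "'g::{group_add, finite} set \<Rightarrow> 'g set \<Rightarrow> nat \<Rightarrow> nat \<Rightarrow> nat \<Rightarrow> nat \<Rightarrow> bool" where
  "relative_difference_set D N m n k l \<longleftrightarrow>
     CARD('g) = m * n \<and> subgroup N (additive_group :: 'g monoid) \<and> card N = n \<and> card D = k \<and>
     (\<forall>g. g \<notin> N \<longrightarrow> card {(a, b). a \<in> D \<and> b \<in> D \<and> a - b = g} = l) \<and>
     (\<forall>g\<in>N - {0}. \<not> (\<exists>a\<in>D. \<exists>b\<in>D. a - b = g))"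

definition twice_Z4 :: "(4 ^ 'n::finite) set" where
  "twice_Z4 = range (\<lambda>g. 2 * g)"

subsection \<open>Boolean functions\<close>

definition anf_monomial :: "'n::finite set \<Rightarrow> bit ^ 'n \<Rightarrow> bit" where
  "anf_monomial u x = (\<Prod>i\<in>u. x $ i)"

text \<open>The coefficients of the reduced polynomial (algebraic normal form) of a Boolean function;
  a set \<open>u\<close> of indices stands for the monomial \<open>\<Prod>i\<in>u. x\<^sub>i\<close>.\<close>

definition anf_coeff :: "(bit ^ 'n::finite \<Rightarrow> bit) \<Rightarrow> 'n set \<Rightarrow> bit" where
  "anf_coeff f = (THE c. \<forall>x. f x = (\<Sum>u\<in>UNIV. c u * anf_monomial u x))"

text \<open>As for \<^const>\<open>degree\<close>, the zero function gets degree 0.\<close>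

definition algebraic_degree :: "(bit ^ 'n::finite \<Rightarrow> bit) \<Rightarrow> nat" where
  "algebraic_degree f = Max (insert 0 {card u | u. anf_coeff f u \<noteq> 0})"

definition remove_affine_terms :: "(bit ^ 'n::finite \<Rightarrow> bit) \<Rightarrow> bit ^ 'n \<Rightarrow> bit" where
  "remove_affine_terms f x = (\<Sum>u | 2 \<le> card u. anf_coeff f u * anf_monomial u x)"

subsection \<open>The representation over \<open>F\<^sub>2\<close>\<close>

definition lift_bit :: "bit \<Rightarrow> 4" where
  "lift_bit b = (if b = 0 then 0 else 1)"

definition lift_vec :: "bit ^ 'n::finite \<Rightarrow> 4 ^ 'n" where
  "lift_vec a = (\<chi> i. lift_bit (a $ i))"

definition Z4_pair :: "bit ^ 'n::finite \<Rightarrow> bit ^ 'n \<Rightarrow> 4 ^ 'n" where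
  "Z4_pair a b = lift_vec a + 2 * lift_vec b"

definition F2_rep :: "(4 ^ 'n::finite) set \<Rightarrow> bit ^ 'n \<Rightarrow> bit ^ 'n" where
  "F2_rep D x = (THE y. Z4_pair x y \<in> D)"

text \<open>If no coordinate function of \<^term>\<open>F2_rep D\<close> has linear or constant terms, then this is
  \<^term>\<open>F2_rep D\<close> itself. In general, dropping these terms amounts to replacing \<open>D\<close> by its image
  under an automorphism of \<open>Z\<^sub>4\<^sup>n\<close> fixing \<open>2 Z\<^sub>4\<^sup>n\<close>, followed by a translation.\<close>

definition normalized_F2_rep :: "(4 ^ 'n::finite) set \<Rightarrow> bit ^ 'n \<Rightarrow> bit ^ 'n" where
  "normalized_F2_rep D x = (\<chi> i. remove_affine_terms (\<lambda>y. F2_rep D y $ i) x)"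

text \<open>Multiplication of vectors is coordinatewise, so \<open>x * y\<close> below is \<open>(x\<^sub>i y\<^sub>i)\<^sub>i\<close>.\<close>

definition ast :: "(bit ^ 'n::finite \<Rightarrow> bit ^ 'n) \<Rightarrow> bit ^ 'n \<Rightarrow> bit ^ 'n \<Rightarrow> bit ^ 'n" where
  "ast h x y = h (x + y) + h x + h y + x * y"

definition last_unit :: "bit ^ 'n::{finite, linorder}" where
  "last_unit = axis (Max UNIV) 1"

definition star ::
    "((bit, 'n::{finite, linorder}) vec \<Rightarrow> (bit, 'n) vec) \<Rightarrow>
      (bit, 'n) vec \<Rightarrow> (bit, 'n) vec \<Rightarrow> (bit, 'n) vec" where
  "star h m x = inv_into UNIV (ast h last_unit) (ast h m x)"

subsection \<open>The representation over a field with \<open>2\<^sup>n\<close> elements\<close>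

definition F2_scale :: "bit \<Rightarrow> 'k::field \<Rightarrow> 'k" where
  "F2_scale c x = (if c = 0 then 0 else x)"

definition F2_basis :: "('n::finite \<Rightarrow> 'k::field) \<Rightarrow> bool" where
  "F2_basis \<xi> \<longleftrightarrow> inj \<xi> \<and> \<not> module.dependent F2_scale (range \<xi>) \<and>
     module.span F2_scale (range \<xi>) = UNIV"

definition from_coords :: "('n::finite \<Rightarrow> 'k::field) \<Rightarrow> bit ^ 'n \<Rightarrow> 'k" where
  "from_coords \<xi> v = (\<Sum>i\<in>UNIV. F2_scale (v $ i) (\<xi> i))"

definition to_coords :: "('n::finite \<Rightarrow> 'k::field) \<Rightarrow> 'k \<Rightarrow> bit ^ 'n" where
  "to_coords \<xi> = inv_into UNIV (from_coords \<xi>)"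

definition basis_mu :: "('n::{finite, linorder} \<Rightarrow> 'k::field) \<Rightarrow> 'k \<Rightarrow> 'k" where
  "basis_mu \<xi> x = (\<Sum>(i, j) | i < j.
     F2_scale (to_coords \<xi> x $ i * to_coords \<xi> x $ j) (\<xi> i * \<xi> j))"

definition field_rep ::
    "('n::{finite, linorder} \<Rightarrow> 'k::field) \<Rightarrow> (4 ^ 'n::{finite, linorder}) set \<Rightarrow> 'k \<Rightarrow> 'k" where
  "field_rep \<xi> D x = (from_coords \<xi> (F2_rep D (to_coords \<xi> x)))\<^sup>2 + basis_mu \<xi> x"

text \<open>The polynomial of a map on a finite field, reduced modulo \<open>x\<^sup>q - x\<close>.\<close>

definition reduced_poly :: "('k::{field, finite} \<Rightarrow> 'k) \<Rightarrow> 'k poly" where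
  "reduced_poly f = (THE p. degree p < CARD('k) \<and> (\<forall>x. poly p x = f x))"

definition remove_linearized_terms :: "'k::field poly \<Rightarrow> 'k poly" where
  "remove_linearized_terms p =
     (\<Sum>k | k \<le> degree p \<and> k \<noteq> 0 \<and> (\<forall>i. k \<noteq> 2 ^ i). monom (coeff p k) k)"

definition normalized_field_rep ::
    "('n::{finite, linorder} \<Rightarrow> 'k::{field, finite}) \<Rightarrow> (4 ^ 'n::{finite, linorder}) set \<Rightarrow> 'k poly" where
  "normalized_field_rep \<xi> D = remove_linearized_terms (reduced_poly (field_rep \<xi> D))"

definition Dembowski_Ostrom :: "'k::field poly \<Rightarrow> bool" where
  "Dembowski_Ostrom p \<longleftrightarrow>
     (\<exists>N (c :: nat \<Rightarrow> nat \<Rightarrow> 'k). p = (\<Sum>i<N. \<Sum>j<N. monom (c i j) (2 ^ i + 2 ^ j)))"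

subsection \<open>Semifields\<close>

definition presemifield ::
    "'s set \<Rightarrow> ('s \<Rightarrow> 's \<Rightarrow> 's) \<Rightarrow> 's \<Rightarrow> ('s \<Rightarrow> 's \<Rightarrow> 's) \<Rightarrow> bool" where
  "presemifield S add z mul \<longleftrightarrow>
     comm_group \<lparr>carrier = S, monoid.mult = add, one = z\<rparr> \<and>
     (\<forall>x\<in>S. \<forall>y\<in>S. mul x y \<in> S) \<and>
     (\<forall>x\<in>S. \<forall>y\<in>S. \<forall>w\<in>S. mul x (add y w) = add (mul x y) (mul x w)) \<and>
     (\<forall>x\<in>S. \<forall>y\<in>S. \<forall>w\<in>S. mul (add x y) w = add (mul x w) (mul y w)) \<and>
     (\<forall>x\<in>S. \<forall>y\<in>S. mul x y = z \<longrightarrow> x = z \<or> y = z)"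

definition semifield ::
    "'s set \<Rightarrow> ('s \<Rightarrow> 's \<Rightarrow> 's) \<Rightarrow> 's \<Rightarrow> ('s \<Rightarrow> 's \<Rightarrow> 's) \<Rightarrow> bool" where
  "semifield S add z mul \<longleftrightarrow>
     presemifield S add z mul \<and> (\<exists>e\<in>S. \<forall>x\<in>S. mul e x = x \<and> mul x e = x)"

definition comm_presemifield ::
    "'s set \<Rightarrow> ('s \<Rightarrow> 's \<Rightarrow> 's) \<Rightarrow> 's \<Rightarrow> ('s \<Rightarrow> 's \<Rightarrow> 's) \<Rightarrow> bool" where
  "comm_presemifield S add z mul \<longleftrightarrow>
     presemifield S add z mul \<and> (\<forall>x\<in>S. \<forall>y\<in>S. mul x y = mul y x)"

definition comm_semifield ::
    "'s set \<Rightarrow> ('s \<Rightarrow> 's \<Rightarrow> 's) \<Rightarrow> 's \<Rightarrow> ('s \<Rightarrow> 's \<Rightarrow> 's) \<Rightarrow> bool" where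
  "comm_semifield S add z mul \<longleftrightarrow>
     semifield S add z mul \<and> (\<forall>x\<in>S. \<forall>y\<in>S. mul x y = mul y x)"

subsection \<open>Projective planes and coordinates\<close>

record ('p, 'l) incidence_structure =
  points :: "'p set"
  lines :: "'l set"
  incident :: "'p \<Rightarrow> 'l \<Rightarrow> bool"

definition projective_plane :: "('p, 'l) incidence_structure \<Rightarrow> bool" where
  "projective_plane P \<longleftrightarrow>
     (\<forall>p\<in>points P. \<forall>q\<in>points P. p \<noteq> q \<longrightarrow>
        (\<exists>!l. l \<in> lines P \<and> incident P p l \<and> incident P q l)) \<and>
     (\<forall>l\<in>lines P. \<forall>k\<in>lines P. l \<noteq> k \<longrightarrow>
        (\<exists>!p. p \<in> points P \<and> incident P p l \<and> incident P p k)) \<and>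
     (\<exists>Q\<subseteq>points P. card Q = 4 \<and>
        (\<forall>l\<in>lines P. card {p \<in> Q. incident P p l} \<le> 2))"

definition isomorphic ::
    "('p, 'l) incidence_structure \<Rightarrow> ('q, 'k) incidence_structure \<Rightarrow> bool" where
  "isomorphic P R \<longleftrightarrow>
     (\<exists>\<alpha> \<beta>. bij_betw \<alpha> (points P) (points R) \<and> bij_betw \<beta> (lines P) (lines R) \<and>
        (\<forall>p\<in>points P. \<forall>l\<in>lines P. incident P p l \<longleftrightarrow> incident R (\<alpha> p) (\<beta> l)))"

datatype 's coord_point = Affine_point 's 's | Slope_point 's | Vertical_point
datatype 's coord_line = Sloped_line 's 's | Vertical_line 's | Infinite_line

text \<open>Points \<open>(x, y)\<close>, \<open>(m)\<close>, \<open>(\<infinity>)\<close>; the lines are \<open>y = m x + k\<close> together with \<open>(m)\<close>,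
  \<open>x = c\<close> together with \<open>(\<infinity>)\<close>, and the line of all \<open>(m)\<close> and \<open>(\<infinity>)\<close>.\<close>

fun coord_incident ::
    "('s \<Rightarrow> 's \<Rightarrow> 's) \<Rightarrow> ('s \<Rightarrow> 's \<Rightarrow> 's) \<Rightarrow> 's coord_point \<Rightarrow> 's coord_line \<Rightarrow> bool" where
  "coord_incident add mul (Affine_point x y) (Sloped_line m k) \<longleftrightarrow> y = add (mul m x) k"
| "coord_incident add mul (Affine_point x y) (Vertical_line c) \<longleftrightarrow> x = c"
| "coord_incident add mul (Affine_point x y) Infinite_line \<longleftrightarrow> False"
| "coord_incident add mul (Slope_point m') (Sloped_line m k) \<longleftrightarrow> m' = m"
| "coord_incident add mul (Slope_point m') (Vertical_line c) \<longleftrightarrow> False"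
| "coord_incident add mul (Slope_point m') Infinite_line \<longleftrightarrow> True"
| "coord_incident add mul Vertical_point (Sloped_line m k) \<longleftrightarrow> False"
| "coord_incident add mul Vertical_point (Vertical_line c) \<longleftrightarrow> True"
| "coord_incident add mul Vertical_point Infinite_line \<longleftrightarrow> True"

definition coord_plane ::
    "'s set \<Rightarrow> ('s \<Rightarrow> 's \<Rightarrow> 's) \<Rightarrow> ('s \<Rightarrow> 's \<Rightarrow> 's) \<Rightarrow>
      ('s coord_point, 's coord_line) incidence_structure" where
  "coord_plane S add mul =
     \<lparr>points = {Affine_point x y | x y. x \<in> S \<and> y \<in> S} \<union> Slope_point ` S \<union> {Vertical_point},
      lines = {Sloped_line m k | m k. m \<in> S \<and> k \<in> S} \<union> Vertical_line ` S \<union> {Infinite_line},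
      incident = coord_incident add mul\<rparr>"

text \<open>Taking the semifield inside the type of points loses no generality: in a plane that is
  coordinatized by \<open>S\<close>, the elements of \<open>S\<close> correspond to the points \<open>(m)\<close>.\<close>

definition comm_semifield_plane :: "('p, 'l) incidence_structure \<Rightarrow> bool" where
  "comm_semifield_plane P \<longleftrightarrow> projective_plane P \<and>
     (\<exists>(S :: 'p set) add z mul.
        comm_semifield S add z mul \<and> isomorphic P (coord_plane S add mul))"

subsection \<open>The plane of a relative difference set\<close>

definition translate :: "'g::group_add set \<Rightarrow> 'g \<Rightarrow> 'g set" where
  "translate A g = (\<lambda>a. a + g) ` A"

definition parallel_class :: "'g::group_add set \<Rightarrow> 'g set \<Rightarrow> 'g \<Rightarrow> 'g set set" where
  "parallel_class D N g = {translate D (g + t) | t. t \<in> N}"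

datatype 'g rds_point = Group_point 'g | Class_point "'g set set" | Infinity_point
datatype 'g rds_line = Translate_line "'g set" | Coset_line "'g set" | Infinity_line

fun rds_incident :: "'g rds_point \<Rightarrow> 'g rds_line \<Rightarrow> bool" where
  "rds_incident (Group_point g) (Translate_line A) \<longleftrightarrow> g \<in> A"
| "rds_incident (Group_point g) (Coset_line A) \<longleftrightarrow> g \<in> A"
| "rds_incident (Group_point g) Infinity_line \<longleftrightarrow> False"
| "rds_incident (Class_point C) (Translate_line A) \<longleftrightarrow> A \<in> C"
| "rds_incident (Class_point C) (Coset_line A) \<longleftrightarrow> False"
| "rds_incident (Class_point C) Infinity_line \<longleftrightarrow> True"
| "rds_incident Infinity_point (Translate_line A) \<longleftrightarrow> False"
| "rds_incident Infinity_point (Coset_line A) \<longleftrightarrow> True"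
| "rds_incident Infinity_point Infinity_line \<longleftrightarrow> True"

definition rds_plane ::
    "'g::group_add set \<Rightarrow> 'g set \<Rightarrow> ('g rds_point, 'g rds_line) incidence_structure" where
  "rds_plane D N =
     \<lparr>points = range Group_point \<union> range (\<lambda>g. Class_point (parallel_class D N g)) \<union>
        {Infinity_point},
      lines = range (\<lambda>g. Translate_line (translate D g)) \<union>
        range (\<lambda>g. Coset_line (translate N g)) \<union> {Infinity_line},
      incident = rds_incident\<rparr>"

definition all_equivalent :: "bool list \<Rightarrow> bool" where
  "all_equivalent Ps \<longleftrightarrow> (\<forall>P\<in>set Ps. \<forall>Q\<in>set Ps. P \<longleftrightarrow> Q)"

end

theory Submission
  imports Defs
begin

text \<open>
  Writing \<open>D\<close> in the coordinates \<open>\<lfloor>x, y\<rfloor>\<close> makes the translates of \<open>D\<close> the lines \<open>y = u * x + k\<close>, so the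
  plane of \<open>D\<close> is the plane coordinatized by \<open>*\<close>, and everything comes down to \<open>*\<close> being
  biadditive. By definition of \<open>*\<close> this says that the third difference of \<open>h\<close> vanishes. Expanding a
  map with vanishing third difference along a basis turns this into degree at most 2; over the
  field, the coordinate functions are linearized polynomials (regularity of a Moore matrix), and
  their products are Dembowski--Ostrom polynomials up to linearized terms.

  For the plane: if it is a semifield plane, it has some translation line. Translations by elements
  of \<open>Z\<^sub>4\<^sup>n\<close> move every line other than \<open>L\<^sub>\<infinity>\<close> to another line with the same point at infinity,
  and two translation lines through a point make every line through that point one; so \<open>L\<^sub>\<infinity>\<close> is a
  translation line. The translations with centre \<open>(0)\<close> then give a map \<open>f\<close> with
  \<open>u * f x = u * x + u * a\<close>, and the identity \<open>x * x = x\<close> forces \<open>f x = x + a\<close>.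
\<close>

subsection \<open>Vanishing third differences\<close>

text \<open>In characteristic 2 the vanishing of this seven-term sum also forces f 0 = 0, which
  suits \<open>h\<close>, since normalization removes the constant terms.

  Three objects are normalized differently: \<open>F2_rep D\<close>, \<open>h\<close>, and the
  polynomial over the field. They are linked by writing \<open>F2_rep D\<close> as h + a + k with
  \<open>a\<close> additive. An additive map has vanishing third difference, cancels from the polar
  form, and only shifts the right-hand side of the planarity equation. So no formula for
  \<open>a\<close> is ever needed, and the two normalizations never have to be matched term by term.

  The coordinatewise product in \<open>ast\<close> is the carry of the addition in Z_4. Being
  biadditive, it does not disturb the third difference, but it is what gives
  \<open>ast h x x = x\<close>.

  The obstacle in the plane is that \<open>ast h\<close> is not known to be distributive, and that a
  coordinatization by a semifield may use quite different coordinates. What survives a change of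
  coordinates is the existence of a translation line; the collineations available to locate it are
  those induced by Z_4^n. Idempotence then does the work for which distributivity would normally be
  used.\<close>

definition third_diff_zero :: "('a::ab_group_add \<Rightarrow> 'b::ab_group_add) \<Rightarrow> bool" where
  "third_diff_zero f \<longleftrightarrow>
     (\<forall>x y z. f (x + y + z) + f (x + y) + f (x + z) + f (y + z) + f x + f y + f z = 0)"

text \<open>These rules would rewrite field arithmetic of bits to bit operations.\<close>

declare add_bit_eq_xor [simp del] mult_bit_eq_and [simp del]

lemma bit_add_self [simp]: "(x :: bit) + x = 0"
  by (cases x) simp_all

lemma vec2_add_self [simp]: "(x :: bit ^ 'n) + x = 0"
  by (simp add: vec_eq_iff bit_add_self)

lemma vec2_add_self_left [simp]: "(x :: bit ^ 'n) + (x + y) = y"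
  by (simp flip: add.assoc)

lemma vec2_two [simp]: "2 * (x :: bit ^ 'n) = 0"
  by (simp add: mult_2)

lemma vec2_mult_self [simp]: "(x :: bit ^ 'n) * x = x"
proof -
  have "b * b = b" for b :: bit by (cases b) simp_all
  then show ?thesis by (simp add: vec_eq_iff)
qed

lemma vec2_eq_iff: "(x :: bit ^ 'n) = y \<longleftrightarrow> x + y = 0"
  by (metis add.right_neutral vec2_add_self vec2_add_self_left)

lemma vec2_diff: "(x :: bit ^ 'n) - y = x + y"
  by (simp add: vec_eq_iff)

lemma char2_add_left:
  fixes x y :: "'b::ab_group_add"
  assumes "\<And>x :: 'b. x + x = 0"
  shows "x + (x + y) = y"
  by (simp add: assms flip: add.assoc)

lemma third_diff_zero_add:
  assumes "third_diff_zero f" "third_diff_zero g"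
  shows "third_diff_zero (\<lambda>x. f x + g x)"
  unfolding third_diff_zero_def
proof (intro allI)
  fix x y z
  have "(f (x + y + z) + f (x + y) + f (x + z) + f (y + z) + f x + f y + f z) +
    (g (x + y + z) + g (x + y) + g (x + z) + g (y + z) + g x + g y + g z) = 0"
    using assms by (simp add: third_diff_zero_def)
  then show "(f (x + y + z) + g (x + y + z)) + (f (x + y) + g (x + y)) + (f (x + z) + g (x + z)) +
     (f (y + z) + g (y + z)) + (f x + g x) + (f y + g y) + (f z + g z) = 0"
    by (simp only: ac_simps)
qed

lemma third_diff_zero_sum:
  assumes "\<And>i. i \<in> A \<Longrightarrow> third_diff_zero (f i)"
  shows "third_diff_zero (\<lambda>x. \<Sum>i\<in>A. f i x)"
  using assms
proof (induction A rule: infinite_finite_induct)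
  case (insert i A)
  then show ?case by (simp add: third_diff_zero_add)
qed (simp_all add: third_diff_zero_def)

lemma third_diff_zero_additive:
  fixes f :: "'a::ab_group_add \<Rightarrow> 'b::ab_group_add"
  assumes "\<And>x :: 'b. x + x = 0" "additive f"
  shows "third_diff_zero f"
  using char2_add_left[OF assms(1)]
  by (simp add: third_diff_zero_def additive.add[OF assms(2)] assms(1) ac_simps)

text \<open>After expansion each f x * g x occurs four times and each mixed product such as f x * g
  y twice. Products of coordinates, of two Frobenius powers, and the summands of
  \<open>basis_mu\<close> all have this form.\<close>

lemma third_diff_zero_mult:
  fixes f g :: "'a::ab_group_add \<Rightarrow> 'b::comm_ring"
  assumes "\<And>x :: 'b. x + x = 0" "additive f" "additive g"
  shows "third_diff_zero (\<lambda>x. f x * g x)"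
  using char2_add_left[OF assms(1)]
  by (simp add: third_diff_zero_def additive.add[OF assms(2)] additive.add[OF assms(3)] assms(1)
      algebra_simps)

lemma third_diff_zero_cong_additive:
  fixes f g :: "'a::ab_group_add \<Rightarrow> 'b::ab_group_add"
  assumes "\<And>x :: 'b. x + x = 0" "additive a" "\<And>x. f x = g x + a x"
  shows "third_diff_zero f \<longleftrightarrow> third_diff_zero g"
proof
  have a: "third_diff_zero a"
    using assms by (simp add: third_diff_zero_additive)
  have g: "g x = f x + a x" for x
    by (simp add: assms add.assoc)
  show "third_diff_zero f" if "third_diff_zero g"
    using third_diff_zero_add[OF that a] by (simp flip: assms(3))
  show "third_diff_zero g" if "third_diff_zero f"
    using third_diff_zero_add[OF that a] by (simp flip: g)
qed

lemma third_diff_zero_comp: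
  assumes "additive a" "third_diff_zero f" "additive b"
  shows "third_diff_zero (\<lambda>x. a (f (b x)))"
  unfolding third_diff_zero_def additive.add[OF assms(3)] additive.add[OF assms(1), symmetric]
  using assms(2) by (simp add: third_diff_zero_def additive.zero[OF assms(1)])

text \<open>The polar form \<open>B\<close> is additive in its first argument, so \<open>f\<close>
  expands like a quadratic form. The order on the indices counts each pair once; because the
  induction adds a new maximum, the inner sums of the old indices stay unchanged.\<close>

lemma third_diff_zero_expansion:
  fixes f :: "'a::ab_group_add \<Rightarrow> 'b::ab_group_add" and y :: "'i::linorder \<Rightarrow> 'a"
  assumes two: "\<And>x :: 'b. x + x = 0" and f: "third_diff_zero f" and f0: "f 0 = 0" and "finite A"
  defines "B \<equiv> \<lambda>x y. f (x + y) + f x + f y"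
  shows "f (\<Sum>i\<in>A. y i) = (\<Sum>i\<in>A. f (y i) + (\<Sum>j | j \<in> A \<and> j < i. B (y j) (y i)))"
  using \<open>finite A\<close>
proof (induction A rule: finite_linorder_max_induct)
  case empty
  then show ?case by (simp add: f0)
next
  case (insert b A)
  note two' = char2_add_left[OF two]
  have B_add: "B (u + v) w = B u w + B v w" for u v w
  proof -
    have "B (u + v) w + (B u w + B v w) =
        f (u + v + w) + f (u + v) + f (u + w) + f (v + w) + f u + f v + f w"
      by (simp add: B_def ac_simps two two')
    also have "\<dots> = 0"
      using f by (simp add: third_diff_zero_def)
    finally show ?thesis
      by (metis add.right_neutral two two' add.assoc)
  qed
  have B_sum: "B (\<Sum>i\<in>C. y i) w = (\<Sum>i\<in>C. B (y i) w)" for C w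
    by (induction C rule: infinite_finite_induct) (simp_all add: B_add, simp_all add: B_def f0 two)
  have b: "b \<notin> A" using insert.hyps by auto
  have "f (\<Sum>i\<in>insert b A. y i) = f ((\<Sum>i\<in>A. y i) + y b)"
    using b insert.hyps by (simp add: add.commute)
  also have "\<dots> = f (\<Sum>i\<in>A. y i) + (f (y b) + B (\<Sum>i\<in>A. y i) (y b))"
    by (simp add: B_def ac_simps two two')
  also have "\<dots> = (\<Sum>i\<in>A. f (y i) + (\<Sum>j | j \<in> A \<and> j < i. B (y j) (y i))) +
      (f (y b) + (\<Sum>j\<in>A. B (y j) (y b)))"
    by (simp add: insert.IH B_sum)
  also have "(\<Sum>j\<in>A. B (y j) (y b)) = (\<Sum>j | j \<in> insert b A \<and> j < b. B (y j) (y b))"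
    using insert.hyps by (intro sum.cong) auto
  also have "(\<Sum>i\<in>A. f (y i) + (\<Sum>j | j \<in> A \<and> j < i. B (y j) (y i))) =
      (\<Sum>i\<in>A. f (y i) + (\<Sum>j | j \<in> insert b A \<and> j < i. B (y j) (y i)))"
    using insert.hyps
    by (intro sum.cong refl arg_cong2[where f = "(+)"]) (auto dest: order.asym)
  finally show ?case
    using b insert.hyps by (simp add: add.commute)
qed

subsection \<open>Algebraic normal forms\<close>

lemma anf_monomial_axes:
  "anf_monomial u (\<chi> i. of_bool (i \<in> v)) = (of_bool (u \<subseteq> v) :: bit)"
proof (cases "u \<subseteq> v")
  case True
  then show ?thesis by (auto simp: anf_monomial_def intro!: prod.neutral)
next
  case False
  then obtain i where "i \<in> u" "i \<notin> v" by blast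
  then show ?thesis
    by (auto simp: anf_monomial_def intro!: prod_zero)
qed

text \<open>At the indicator vector of v the polynomial becomes the sum of the coefficients of all
  subsets of v. This triangular system is solved by induction on \<open>card v\<close>.\<close>

lemma anf_unique:
  fixes c d :: "'n::finite set \<Rightarrow> bit"
  assumes "\<And>x. (\<Sum>u\<in>UNIV. c u * anf_monomial u x) = (\<Sum>u\<in>UNIV. d u * anf_monomial u x)"
  shows "c = d"
proof
  fix v
  show "c v = d v"
  proof (induction "card v" arbitrary: v rule: less_induct)
    case less
    have *: "(\<Sum>u\<in>UNIV. c u * anf_monomial u (\<chi> i. of_bool (i \<in> v))) = c v + (\<Sum>u | u \<subset> v. c u)"
      for c :: "'n set \<Rightarrow> bit"
    proof -
      have "(\<Sum>u\<in>UNIV. c u * anf_monomial u (\<chi> i. of_bool (i \<in> v))) = (\<Sum>u\<in>Pow v. c u)"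
        by (intro sum.mono_neutral_cong_right) (auto simp: anf_monomial_axes)
      also have "Pow v = insert v {u. u \<subset> v}" by auto
      finally show ?thesis by simp
    qed
    have "c v + (\<Sum>u | u \<subset> v. c u) = d v + (\<Sum>u | u \<subset> v. d u)"
      using assms[of "\<chi> i. of_bool (i \<in> v)"] unfolding * .
    moreover have "(\<Sum>u | u \<subset> v. c u) = (\<Sum>u | u \<subset> v. d u)"
      using less by (intro sum.cong) (auto simp: psubset_card_mono)
    ultimately show ?case by (metis add_right_cancel)
  qed
qed

instance bit :: finite
proof
  have "(UNIV :: bit set) = {0, 1}" using bit.exhaust by auto
  then show "finite (UNIV :: bit set)" by (metis finite.emptyI finite.insertI)
qed

lemma card_bit: "CARD(bit) = 2"
proof -
  have "(UNIV :: bit set) = {0, 1}" using bit.exhaust by auto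
  then have "CARD(bit) = card {0 :: bit, 1}" by metis
  then show ?thesis by simp
qed

text \<open>Coefficient families and Boolean functions are equally numerous, so the evaluation map
  \<open>T\<close>, injective by \<open>anf_unique\<close>, is onto.\<close>

lemma anf_exists:
  fixes f :: "bit ^ 'n::finite \<Rightarrow> bit"
  shows "\<exists>c. \<forall>x. f x = (\<Sum>u\<in>UNIV. c u * anf_monomial u x)"
proof -
  define T :: "('n set \<Rightarrow> bit) \<Rightarrow> bit ^ 'n \<Rightarrow> bit"
    where "T c x = (\<Sum>u\<in>UNIV. c u * anf_monomial u x)" for c x
  have "inj T"
    by (intro injI anf_unique) (metis T_def)
  have "CARD('n set \<Rightarrow> bit) = CARD(bit ^ 'n \<Rightarrow> bit)"
    by (simp add: card_fun card_bit)
  then have "card (range T) = CARD(bit ^ 'n \<Rightarrow> bit)"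
    using card_image[OF \<open>inj T\<close>] by simp
  then have "range T = UNIV"
    by (intro card_subset_eq) auto
  then obtain c where "f = T c" by blast
  then show ?thesis by (auto simp: T_def)
qed

lemma anf_coeff_eqI:
  assumes "\<And>x. f x = (\<Sum>u\<in>UNIV. c u * anf_monomial u x)"
  shows "anf_coeff f = c"
  unfolding anf_coeff_def using assms by (intro the_equality anf_unique) auto

lemma anf_expansion: "f x = (\<Sum>u\<in>UNIV. anf_coeff f u * anf_monomial u x)"
  using anf_exists[of f] anf_coeff_eqI by metis

lemma anf_coeff_sum:
  "anf_coeff (\<lambda>x. \<Sum>i\<in>A. f i x) u = (\<Sum>i\<in>A. anf_coeff (f i) u)"
proof -
  have "anf_coeff (\<lambda>x. \<Sum>i\<in>A. f i x) = (\<lambda>u. \<Sum>i\<in>A. anf_coeff (f i) u)"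
  proof (rule anf_coeff_eqI)
    fix x
    have "(\<Sum>i\<in>A. f i x) = (\<Sum>i\<in>A. \<Sum>u\<in>UNIV. anf_coeff (f i) u * anf_monomial u x)"
      by (simp only: anf_expansion[symmetric])
    also have "\<dots> = (\<Sum>u\<in>UNIV. (\<Sum>i\<in>A. anf_coeff (f i) u) * anf_monomial u x)"
      by (subst sum.swap) (simp only: sum_distrib_right)
    finally show "(\<Sum>i\<in>A. f i x) = (\<Sum>u\<in>UNIV. (\<Sum>i\<in>A. anf_coeff (f i) u) * anf_monomial u x)" .
  qed
  then show ?thesis by simp
qed

lemma anf_coeff_add: "anf_coeff (\<lambda>x. f x + g x) u = anf_coeff f u + anf_coeff g u"
proof -
  have "anf_coeff (\<lambda>x. f x + g x) = (\<lambda>u. anf_coeff f u + anf_coeff g u)"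
    by (rule anf_coeff_eqI)
      (simp only: distrib_right sum.distrib anf_expansion[symmetric])
  then show ?thesis by simp
qed

lemma anf_coeff_monomial:
  "anf_coeff (\<lambda>x. k * anf_monomial v x) u = (if u = v then k else 0)"
proof -
  have "anf_coeff (\<lambda>x. k * anf_monomial v x) = (\<lambda>u. if u = v then k else 0)"
    by (rule anf_coeff_eqI) (simp add: if_distrib[of "\<lambda>c. c * _"] cong: if_cong)
  then show ?thesis by simp
qed

lemma algebraic_degree_le_iff:
  "algebraic_degree f \<le> d \<longleftrightarrow> (\<forall>u. anf_coeff f u \<noteq> 0 \<longrightarrow> card u \<le> d)"
proof -
  have "finite {card u | u. anf_coeff f u \<noteq> 0}"
    by (rule finite_subset[of _ "range card"]) auto
  then show ?thesis
    unfolding algebraic_degree_def by (subst Max_le_iff) auto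
qed

lemma anf_monomial_zero: "anf_monomial u 0 = of_bool (u = {})"
  by (auto simp: anf_monomial_def)

lemma anf_coeff_empty: "anf_coeff f {} = f 0"
proof -
  have "f 0 = (\<Sum>u\<in>UNIV. if u = {} then anf_coeff f u else 0)"
    by (subst anf_expansion[of f 0]) (intro sum.cong, auto simp: anf_monomial_zero)
  then show ?thesis by simp
qed

lemma additive_vec_nth: "additive (\<lambda>x :: 'a::ab_group_add ^ 'n. x $ i)"
  by (simp add: additive_def)

lemma additive_anf_monomial:
  assumes "card u = 1"
  shows "additive (\<lambda>x. k * anf_monomial u x)"
proof -
  obtain i where "u = {i}" using assms by (rule card_1_singletonE)
  then have "anf_monomial u x = x $ i" for x
    by (simp add: anf_monomial_def)
  then show ?thesis
    by (simp only: additive_def vector_add_component distrib_left) simp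
qed

lemma additive_sum:
  assumes "\<And>i. i \<in> A \<Longrightarrow> additive (f i)"
  shows "additive (\<lambda>x. \<Sum>i\<in>A. f i x)"
  using assms by (simp add: additive_def sum.distrib)

text \<open>The normal form is split by degree: monomials in one variable are additive, and the
  empty monomial contributes \<open>f 0\<close>.\<close>

lemma remove_affine_terms_diff:
  fixes f :: "bit ^ 'n::finite \<Rightarrow> bit"
  shows "\<exists>a. additive a \<and> (\<forall>x. f x = remove_affine_terms f x + a x + f 0)"
proof (intro exI conjI allI)
  let ?a = "\<lambda>x. \<Sum>u | card u = 1. anf_coeff f u * anf_monomial u x"
  show "additive ?a"
    by (intro additive_sum additive_anf_monomial) simp
  fix x
  let ?A = "{u :: 'n set. 2 \<le> card u}" and ?B = "{u :: 'n set. card u = 1}" and ?C = "{{} :: 'n set}"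
  have "u \<in> (?A \<union> ?B) \<union> ?C" for u
  proof -
    have "2 \<le> card u \<or> card u = 1 \<or> card u = 0" by linarith
    then show ?thesis by auto
  qed
  then have U: "UNIV = (?A \<union> ?B) \<union> ?C" by blast
  have "f x = (\<Sum>u\<in>UNIV. anf_coeff f u * anf_monomial u x)"
    by (rule anf_expansion)
  also have "\<dots> = (\<Sum>u\<in>?A \<union> ?B. anf_coeff f u * anf_monomial u x) +
      (\<Sum>u\<in>?C. anf_coeff f u * anf_monomial u x)"
    unfolding U by (rule sum.union_disjoint) auto
  also have "(\<Sum>u\<in>?A \<union> ?B. anf_coeff f u * anf_monomial u x) = remove_affine_terms f x + ?a x"
    unfolding remove_affine_terms_def by (rule sum.union_disjoint) auto
  finally show "f x = remove_affine_terms f x + ?a x + f 0"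
    by (simp add: anf_coeff_empty anf_monomial_def)
qed

lemma remove_affine_terms_zero: "remove_affine_terms f 0 = 0"
  unfolding remove_affine_terms_def by (intro sum.neutral) (auto simp: anf_monomial_zero)

text \<open>In one direction every monomial that occurs is a product of at most two additive maps.
  In the other, expanding along the unit vectors yields an explicit normal form in the monomials {i}
  and {j, i}, and uniqueness identifies its coefficients. The constant 1 has degree 0 but third
  difference 1, whence the hypothesis on \<open>f 0\<close>.\<close>

lemma algebraic_degree_le_2_iff:
  fixes f :: "bit ^ 'n::{finite, linorder} \<Rightarrow> bit"
  assumes f0: "f 0 = 0"
  shows "algebraic_degree f \<le> 2 \<longleftrightarrow> third_diff_zero f"
proof
  assume *: "algebraic_degree f \<le> 2"
  have "third_diff_zero (\<lambda>x. anf_coeff f u * anf_monomial u x)" for u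
  proof -
    consider "anf_coeff f u = 0" | "card u = 0" | "card u = 1" | "card u = 2"
    proof (cases "anf_coeff f u = 0")
      case False
      then have "card u \<le> 2"
        using * by (simp add: algebraic_degree_le_iff)
      then have "card u = 0 \<or> card u = 1 \<or> card u = 2" by linarith
      then show ?thesis using that by blast
    qed (use that in blast)
    then show ?thesis
    proof cases
      case 1
      then show ?thesis by (simp add: third_diff_zero_def)
    next
      case 2
      then have "anf_coeff f u = 0"
        by (simp add: anf_coeff_empty f0)
      then show ?thesis by (simp add: third_diff_zero_def)
    next
      case 3
      then show ?thesis
        by (intro third_diff_zero_additive bit_add_self additive_anf_monomial)
    next
      case 4
      then obtain i j where u: "u = {i, j}" "i \<noteq> j"
        by (auto simp: card_2_iff)
      have "additive (\<lambda>x. anf_coeff f u * x $ i)"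
        by (simp only: additive_def vector_add_component distrib_left) simp
      from third_diff_zero_mult[OF bit_add_self this additive_vec_nth[of j]]
      show ?thesis using u by (simp add: anf_monomial_def mult.assoc)
    qed
  qed
  then have "third_diff_zero (\<lambda>x. \<Sum>u\<in>UNIV. anf_coeff f u * anf_monomial u x)"
    by (rule third_diff_zero_sum)
  then show "third_diff_zero f"
    by (simp only: anf_expansion[symmetric])
next
  assume *: "third_diff_zero f"
  define B where "B x y = f (x + y) + f x + f y" for x y
  have f_axis: "f (axis i b) = b * f (axis i 1)" for i b
    by (cases b) (simp_all add: f0 iffD2[OF axis_eq_0_iff])
  have B_axis: "B (axis j b) (axis i c) = b * c * B (axis j 1) (axis i 1)" for i j b c
  proof -
    have "axis k (0 :: bit) = 0" for k :: 'n by (simp add: axis_eq_0_iff)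
    then show ?thesis
      by (cases b; cases c) (simp_all only: B_def f0 bit_add_self mult_zero_left mult_zero_right
          mult_1 add_0_left add_0_right)
  qed
  have "f x = (\<Sum>i\<in>UNIV. f (axis i 1) * anf_monomial {i} x +
      (\<Sum>j | j < i. B (axis j 1) (axis i 1) * anf_monomial {j, i} x))" for x
  proof -
    have "f x = f (\<Sum>i\<in>UNIV. axis i (x $ i))"
      by (rule arg_cong[where f = f]) (simp add: vec_eq_iff axis_def)
    also have "\<dots> = (\<Sum>i\<in>UNIV. f (axis i (x $ i)) +
        (\<Sum>j | j \<in> UNIV \<and> j < i. B (axis j (x $ j)) (axis i (x $ i))))"
      unfolding B_def by (intro third_diff_zero_expansion bit_add_self * f0) simp
    also have "\<dots> = (\<Sum>i\<in>UNIV. f (axis i 1) * anf_monomial {i} x +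
        (\<Sum>j | j < i. B (axis j 1) (axis i 1) * anf_monomial {j, i} x))"
    proof (intro sum.cong refl arg_cong2[where f = "(+)"])
      fix i j
      show "f (axis i (x $ i)) = f (axis i 1) * anf_monomial {i} x"
        by (subst f_axis) (simp add: anf_monomial_def mult.commute)
      assume "j \<in> {j. j < i}"
      then show "B (axis j (x $ j)) (axis i (x $ i)) = B (axis j 1) (axis i 1) * anf_monomial {j, i} x"
        by (subst B_axis) (auto simp: anf_monomial_def mult.commute)
    qed simp
    finally show ?thesis .
  qed
  then have "f = (\<lambda>x. \<Sum>i\<in>UNIV. f (axis i 1) * anf_monomial {i} x +
      (\<Sum>j | j < i. B (axis j 1) (axis i 1) * anf_monomial {j, i} x))"
    by (rule ext)
  then have "anf_coeff f u = anf_coeff (\<lambda>x. \<Sum>i\<in>UNIV. f (axis i 1) * anf_monomial {i} x +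
      (\<Sum>j | j < i. B (axis j 1) (axis i 1) * anf_monomial {j, i} x)) u" for u
    by (rule arg_cong)
  also have "\<dots> u = (\<Sum>i\<in>UNIV. (if u = {i} then f (axis i 1) else 0) +
      (\<Sum>j | j < i. if u = {j, i} then B (axis j 1) (axis i 1) else 0))" for u
    by (simp only: anf_coeff_sum anf_coeff_add anf_coeff_monomial)
  finally have coeff: "anf_coeff f u = (\<Sum>i\<in>UNIV. (if u = {i} then f (axis i 1) else 0) +
      (\<Sum>j | j < i. if u = {j, i} then B (axis j 1) (axis i 1) else 0))" for u .
  have "anf_coeff f u = 0" if "\<not> card u \<le> 2" for u
    unfolding coeff
  proof (intro sum.neutral ballI)
    fix i
    have "u \<noteq> {i}" "\<And>j. u \<noteq> {j, i}"
      using that by (auto simp: card_insert_if split: if_splits)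
    then show "(if u = {i} then f (axis i 1) else 0) +
      (\<Sum>j | j < i. if u = {j, i} then B (axis j 1) (axis i 1) else 0) = 0"
      by (simp only: if_False sum.neutral_const add_0_left)
  qed
  then show "algebraic_degree f \<le> 2"
    unfolding algebraic_degree_le_iff by blast
qed

lemma third_diff_zero_comp_iff:
  assumes "additive a" "inj a" "additive b" "surj b"
  shows "third_diff_zero (\<lambda>x. a (f (b x))) \<longleftrightarrow> third_diff_zero f"
proof
  assume *: "third_diff_zero (\<lambda>x. a (f (b x)))"
  show "third_diff_zero f"
    unfolding third_diff_zero_def
  proof (intro allI)
    fix x y z
    obtain x' y' z' where xyz: "x = b x'" "y = b y'" "z = b z'"
      using \<open>surj b\<close> by (meson surjD)
    have "a (f (x + y + z) + f (x + y) + f (x + z) + f (y + z) + f x + f y + f z) = a 0"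
      using * unfolding third_diff_zero_def xyz additive.add[OF assms(1)] additive.add[OF assms(3)]
        additive.zero[OF assms(1)] by blast
    then show "f (x + y + z) + f (x + y) + f (x + z) + f (y + z) + f x + f y + f z = 0"
      using \<open>inj a\<close> by (simp add: inj_eq)
  qed
qed (rule third_diff_zero_comp[OF assms(1) _ assms(3)])

subsection \<open>Finite fields of characteristic two\<close>

text \<open>Adding 1 permutes the field; comparing the sums over all elements shows that the number
  of elements is 0 in the field.\<close>

lemma char2_if_card_power2:
  assumes "CARD('k::{field, finite}) = 2 ^ n"
  shows "(x :: 'k) + x = 0"
proof -
  have "(\<Sum>x\<in>UNIV. x + 1 :: 'k) = \<Sum>UNIV"
    by (rule sum.reindex_bij_witness[of _ "\<lambda>x. x - 1" "\<lambda>x. x + 1"]) auto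
  then have "of_nat (2 ^ n) = (0 :: 'k)"
    by (simp add: sum.distrib assms)
  then have "(2 :: 'k) = 0" by simp
  then show ?thesis by (simp flip: mult_2)
qed

lemma power2_power_add:
  fixes x y :: "'k::comm_ring_1"
  assumes "\<And>x :: 'k. x + x = 0"
  shows "(x + y) ^ 2 ^ i = x ^ 2 ^ i + y ^ 2 ^ i"
proof (induction i)
  case (Suc i)
  have "2 * (x ^ 2 ^ i * y ^ 2 ^ i) = 0"
    by (simp only: mult_2 assms)
  then show ?case
    by (simp add: power_mult mult.commute[of 2] Suc power2_sum mult.assoc)
qed simp

lemma additive_power2_power:
  fixes c :: "'k::comm_ring_1"
  assumes "\<And>x :: 'k. x + x = 0"
  shows "additive (\<lambda>x. c * x ^ 2 ^ i)"
  by (simp add: additive_def power2_power_add[OF assms] distrib_left)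

lemma third_diff_zero_Dembowski_Ostrom:
  fixes p :: "'k::field poly"
  assumes two: "\<And>x :: 'k. x + x = 0" and "Dembowski_Ostrom p"
  shows "third_diff_zero (poly p)"
proof -
  obtain N c where p: "p = (\<Sum>i<N. \<Sum>j<N. monom (c i j) (2 ^ i + 2 ^ j))"
    using assms(2) by (auto simp: Dembowski_Ostrom_def)
  \<comment> \<open>The factor 1 gives the second power the shape expected by
    \<open>additive_power2_power\<close>.\<close>
  have "third_diff_zero (\<lambda>x. (c i j * x ^ 2 ^ i) * (1 * x ^ 2 ^ j))" for i j
    by (intro third_diff_zero_mult two additive_power2_power)
  then have "third_diff_zero (\<lambda>x. \<Sum>i<N. \<Sum>j<N. (c i j * x ^ 2 ^ i) * (1 * x ^ 2 ^ j))"
    by (intro third_diff_zero_sum)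
  also have "(\<lambda>x. \<Sum>i<N. \<Sum>j<N. (c i j * x ^ 2 ^ i) * (1 * x ^ 2 ^ j)) = poly p"
    by (simp add: p fun_eq_iff poly_sum poly_monom power_add mult.assoc)
  finally show ?thesis .
qed

section \<open>Reduced polynomials and the removal of linearized terms\<close>

lemma ex_interpolating_poly:
  fixes f :: "'k::{field, finite} \<Rightarrow> 'k"
  shows "\<exists>p. degree p < CARD('k) \<and> (\<forall>x. poly p x = f x)"
proof -
  \<comment> \<open>Lagrange basis without normalization: \<open>L a\<close> vanishes exactly off a,
    and the division by its value at a takes place in \<open>p\<close>.\<close>
  define L :: "'k \<Rightarrow> 'k poly" where "L a = (\<Prod>b\<in>UNIV - {a}. [:- b, 1:])" for a
  have L: "poly (L a) x = 0 \<longleftrightarrow> x \<noteq> a" for a x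
    by (auto simp: L_def poly_prod)
  have "degree (L a) = CARD('k) - 1" for a
    unfolding L_def by (subst degree_prod_eq_sum_degree) (auto simp: card_Diff_singleton)
  then have deg: "degree (smult c (L a)) \<le> CARD('k) - 1" for a c
    using degree_smult_le[of c "L a"] by simp
  define p where "p = (\<Sum>a\<in>UNIV. smult (f a / poly (L a) a) (L a))"
  have "degree p \<le> CARD('k) - 1"
    unfolding p_def by (intro degree_sum_le deg) simp
  then have "degree p < CARD('k)"
    using zero_less_card_finite[where 'a = 'k] by linarith
  moreover have "poly p x = f x" for x
  proof -
    have "poly p x = (\<Sum>a\<in>UNIV. if a = x then f x else 0)"
      unfolding p_def poly_sum poly_smult
      by (intro sum.cong refl) (use L in auto)
    then show ?thesis by simp
  qed
  ultimately show ?thesis by blast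
qed

lemma reduced_poly:
  fixes f :: "'k::{field, finite} \<Rightarrow> 'k"
  shows "degree (reduced_poly f) < CARD('k)" "poly (reduced_poly f) x = f x"
proof -
  have "\<exists>!p. degree p < CARD('k) \<and> (\<forall>x. poly p x = f x)"
    using ex_interpolating_poly[of f]
    by (auto intro: poly_eqI_degree[where A = "UNIV :: 'k set"])
  from theI'[OF this] show "degree (reduced_poly f) < CARD('k)" "poly (reduced_poly f) x = f x"
    by (auto simp: reduced_poly_def)
qed

lemma coeff_remove_linearized_terms:
  "coeff (remove_linearized_terms p) k = (if k \<noteq> 0 \<and> (\<forall>i. k \<noteq> 2 ^ i) then coeff p k else 0)"
proof -
  have "finite {k. k \<le> degree p \<and> k \<noteq> 0 \<and> (\<forall>i. k \<noteq> 2 ^ i)}"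
    by (rule finite_subset[of _ "{..degree p}"]) auto
  moreover have "coeff p k = 0" if "\<not> k \<le> degree p"
    using that by (simp add: coeff_eq_0)
  ultimately show ?thesis
    by (auto simp: remove_linearized_terms_def coeff_sum)
qed

lemma degree_remove_linearized_terms: "degree (remove_linearized_terms p) \<le> degree p"
  by (rule degree_le) (simp add: coeff_remove_linearized_terms coeff_eq_0)

text \<open>Exponents 2 ^ i give additive maps because they are powers of Frobenius, and exponent 0
  gives the value at 0.\<close>

lemma poly_remove_linearized_terms:
  fixes p :: "'k::field poly"
  assumes two: "\<And>x :: 'k. x + x = 0"
  shows "\<exists>a. additive a \<and> (\<forall>x. poly p x = poly (remove_linearized_terms p) x + a x + poly p 0)"
proof (intro exI conjI allI)
  let ?a = "\<lambda>x. \<Sum>k | k \<le> degree p \<and> (\<exists>i. k = 2 ^ i). coeff p k * x ^ k"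
  show "additive ?a"
    by (intro additive_sum) (auto intro!: additive_power2_power two)
  fix x
  let ?A = "{k. k \<le> degree p \<and> k \<noteq> 0 \<and> (\<forall>i. k \<noteq> 2 ^ i)}"
    and ?B = "{k. k \<le> degree p \<and> (\<exists>i. k = 2 ^ i)}"
  have fin: "finite ?A" "finite ?B"
    by (rule finite_subset[of _ "{..degree p}"]; auto)+
  have "poly p x = (\<Sum>k\<le>degree p. coeff p k * x ^ k)"
    by (rule poly_altdef)
  also have "{..degree p} = (?A \<union> ?B) \<union> {0}"
    by auto
  also have "(\<Sum>k\<in>(?A \<union> ?B) \<union> {0}. coeff p k * x ^ k) =
      (\<Sum>k\<in>?A \<union> ?B. coeff p k * x ^ k) + (\<Sum>k\<in>{0}. coeff p k * x ^ k)"
    using fin by (intro sum.union_disjoint) auto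
  also have "(\<Sum>k\<in>?A \<union> ?B. coeff p k * x ^ k) = (\<Sum>k\<in>?A. coeff p k * x ^ k) + ?a x"
    using fin by (intro sum.union_disjoint) auto
  finally show "poly p x = poly (remove_linearized_terms p) x + ?a x + poly p 0"
    by (simp add: remove_linearized_terms_def poly_sum poly_monom poly_0_coeff_0)
qed

subsection \<open>Coordinates with respect to a basis\<close>

lemma F2_scale_add:
  assumes "\<And>x :: 'k::field. x + x = 0"
  shows "F2_scale (b + c) (x :: 'k) = F2_scale b x + F2_scale c x"
  using assms by (cases b; cases c) (simp_all add: F2_scale_def)

lemma F2_scale_mult: "F2_scale b x = F2_scale b 1 * x"
  by (simp add: F2_scale_def)

lemma additive_from_coords:
  assumes "\<And>x :: 'k::field. x + x = 0"
  shows "additive (from_coords \<xi> :: _ \<Rightarrow> 'k)"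
  by (simp add: additive_def from_coords_def F2_scale_add[OF assms] sum.distrib)

lemma additive_from_coords_eq:
  assumes "additive f"
  shows "f (from_coords \<xi> v) = (\<Sum>i\<in>UNIV. F2_scale (v $ i) (f (\<xi> i)))"
  unfolding from_coords_def additive.sum[OF assms]
  by (intro sum.cong refl) (simp add: F2_scale_def additive.zero[OF assms])

lemma surj_from_coords:
  fixes \<xi> :: "'n::finite \<Rightarrow> 'k::field"
  assumes two: "\<And>x :: 'k. x + x = 0" and "F2_basis \<xi>"
  shows "surj (from_coords \<xi>)"
proof -
  have "module (F2_scale :: bit \<Rightarrow> 'k \<Rightarrow> 'k)"
  proof
    fix a b x
    show "F2_scale (a + b) (x :: 'k) = F2_scale a x + F2_scale b x"
      by (rule F2_scale_add[OF two])
    show "F2_scale a (F2_scale b x) = F2_scale (a * b) (x :: 'k)"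
      by (cases a; cases b) (simp_all add: F2_scale_def)
  qed (simp_all add: F2_scale_def)
  then have U: "UNIV = range (\<lambda>u. \<Sum>v\<in>range \<xi>. F2_scale (u v) v)"
    using assms(2) by (simp add: F2_basis_def module.span_finite)
  have *: "(\<Sum>v\<in>range \<xi>. F2_scale (u v) v) = from_coords \<xi> (\<chi> i. u (\<xi> i))" for u
    using assms(2) by (simp add: F2_basis_def sum.reindex from_coords_def)
  have "y \<in> range (from_coords \<xi>)" for y
    using UNIV_I[of y] unfolding U * by blast
  then show ?thesis by blast
qed

context
  fixes \<xi> :: "'n::{finite, linorder} \<Rightarrow> 'k::{field, finite}"
  assumes card_field: "CARD('k) = 2 ^ CARD('n)" and basis: "F2_basis \<xi>"
begin

lemmas field_add_self = char2_if_card_power2[OF card_field]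

lemma bij_from_coords: "bij (from_coords \<xi>)"
proof -
  have "card (range (from_coords \<xi>)) = card (UNIV :: (bit, 'n) vec set)"
    using surj_from_coords[OF field_add_self basis] card_field by (simp add: card_bit)
  then show ?thesis
    using surj_from_coords[OF field_add_self basis] by (intro bijI eq_card_imp_inj_on) simp_all
qed

lemma from_coords_to_coords [simp]: "from_coords \<xi> (to_coords \<xi> x) = x"
  using bij_from_coords by (simp add: to_coords_def bij_is_surj surj_f_inv_f)

lemma to_coords_from_coords [simp]: "to_coords \<xi> (from_coords \<xi> v) = v"
  using bij_from_coords by (simp add: to_coords_def bij_is_inj)

lemma additive_to_coords: "additive (to_coords \<xi>)"
proof
  fix x y
  have "from_coords \<xi> (to_coords \<xi> x + to_coords \<xi> y) = x + y"
    by (simp add: additive.add[OF additive_from_coords[OF field_add_self]])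
  then show "to_coords \<xi> (x + y) = to_coords \<xi> x + to_coords \<xi> y"
    by (metis to_coords_from_coords)
qed

lemma additive_eqI:
  fixes f g :: "'k \<Rightarrow> 'k"
  assumes "additive f" "additive g" "\<And>i. f (\<xi> i) = g (\<xi> i)"
  shows "f x = g x"
  using additive_from_coords_eq[OF assms(1), of \<xi> "to_coords \<xi> x"]
    additive_from_coords_eq[OF assms(2), of \<xi> "to_coords \<xi> x"] assms(3) by simp

text \<open>The matrix of all \<open>\<xi>\<^sub>j ^ (2 ^ i)\<close> (a Moore matrix) is regular, because a linearized
  polynomial of degree less than \<open>2 ^ n\<close> that vanishes on a basis has \<open>2 ^ n\<close> zeros.\<close>

lemma additive_imp_linearized:
  fixes g :: "'k \<Rightarrow> 'k"
  assumes "additive g"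
  shows "\<exists>a. \<forall>x. g x = (\<Sum>i<CARD('n). a i * x ^ 2 ^ i)"
proof -
  \<comment> \<open>Numbering the indices by exponents makes the Moore map \<open>T\<close> a
    self-map of one finite type, so injectivity yields surjectivity.\<close>
  obtain e where e: "bij_betw e (UNIV :: 'n set) {..<CARD('n)}"
    using ex_bij_betw_finite_nat[of "UNIV :: 'n set"] by (auto simp: atLeast0LessThan)
  define T :: "('n \<Rightarrow> 'k) \<Rightarrow> 'n \<Rightarrow> 'k" where "T a j = (\<Sum>i\<in>UNIV. a i * \<xi> j ^ 2 ^ e i)" for a j
  have add: "additive (\<lambda>x. \<Sum>i\<in>UNIV. a i * x ^ 2 ^ e i)" for a :: "'n \<Rightarrow> 'k"
    by (intro additive_sum additive_power2_power field_add_self)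
  have "inj T"
  proof (rule injI)
    fix a b assume "T a = T b"
    define p where "p a = (\<Sum>i\<in>UNIV. monom (a i) (2 ^ e i))" for a :: "'n \<Rightarrow> 'k"
    have p: "poly (p a) x = (\<Sum>i\<in>UNIV. a i * x ^ 2 ^ e i)" for a x
      by (simp add: p_def poly_sum poly_monom)
    have deg: "degree (p a) < card (UNIV :: 'k set)" for a
    proof -
      have "e i < CARD('n)" for i
        using bij_betwE[OF e] by blast
      then have "e i \<le> CARD('n) - 1" for i
        by (simp add: Suc_leI le_diff_conv2 flip: less_eq_Suc_le)
      then have "degree (monom (a i) (2 ^ e i)) \<le> 2 ^ (CARD('n) - 1)" for i
        by (intro order_trans[OF degree_monom_le]) simp
      then have "degree (p a) \<le> 2 ^ (CARD('n) - 1)"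
        unfolding p_def by (intro degree_sum_le) auto
      also have "\<dots> < 2 ^ CARD('n)" by simp
      finally show ?thesis by (simp add: card_field)
    qed
    have "p a = p b"
    proof (rule poly_eqI_degree[OF _ deg deg])
      show "poly (p a) x = poly (p b) x" for x
        unfolding p by (rule additive_eqI[OF add add]) (metis T_def \<open>T a = T b\<close>)
    qed
    have coeff: "coeff (p a) (2 ^ e i) = a i" for a i
      using bij_betw_imp_inj_on[OF e] by (simp add: p_def coeff_sum inj_eq)
    show "a = b"
      using \<open>p a = p b\<close> by (metis coeff ext)
  qed
  then have "surj T"
    by (rule finite_UNIV_inj_surj[OF finite])
  then obtain a where a: "T a = (\<lambda>j. g (\<xi> j))"
    by (metis surjD)
  have "g x = (\<Sum>i\<in>UNIV. a i * x ^ 2 ^ e i)" for x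
    by (rule additive_eqI[OF assms add]) (use a in \<open>simp add: T_def fun_eq_iff\<close>)
  also have "\<dots> x = (\<Sum>i<CARD('n). a (inv_into UNIV e i) * x ^ 2 ^ i)" for x
    by (subst sum.reindex_bij_betw[OF e, symmetric])
      (simp add: inv_into_f_f[OF bij_betw_imp_inj_on[OF e]])
  finally show ?thesis
    by (intro exI[of _ "\<lambda>i. a (inv_into UNIV e i)"] allI)
qed

section \<open>Dembowski-Ostrom functions modulo additive functions\<close>

lemma sum_square_split:
  fixes g :: "nat \<Rightarrow> nat \<Rightarrow> 'a::ab_group_add"
  shows "(\<Sum>k<n. \<Sum>l<n. g k l) = (\<Sum>l<n. \<Sum>k<l. g k l + g l k) + (\<Sum>k<n. g k k)"
  by (induction n) (simp_all add: sum.distrib algebra_simps)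

text \<open>The restriction k < l makes this a reduced form: the exponents with k = l are powers of
  two and belong to the additive part, while 2 ^ k + 2 ^ l with k < l < n stays below 2 ^ n.\<close>

definition DO_plus_additive :: "('k \<Rightarrow> 'k) \<Rightarrow> bool" where
  "DO_plus_additive f \<longleftrightarrow> (\<exists>c a. additive a \<and>
     (\<forall>x. f x = (\<Sum>l<CARD('n). \<Sum>k<l. c k l * x ^ (2 ^ k + 2 ^ l)) + a x))"

lemma DO_plus_additive_additive:
  assumes "additive a"
  shows "DO_plus_additive a"
  unfolding DO_plus_additive_def
  by (rule exI[of _ "\<lambda>_ _. 0"], rule exI[of _ a]) (simp add: assms)

lemma DO_plus_additive_add:
  assumes "DO_plus_additive f" "DO_plus_additive g"
  shows "DO_plus_additive (\<lambda>x. f x + g x)"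
proof -
  obtain c a where f: "additive a" "\<And>x. f x = (\<Sum>l<CARD('n). \<Sum>k<l. c k l * x ^ (2 ^ k + 2 ^ l)) + a x"
    using assms(1) by (auto simp: DO_plus_additive_def)
  obtain d b where g: "additive b" "\<And>x. g x = (\<Sum>l<CARD('n). \<Sum>k<l. d k l * x ^ (2 ^ k + 2 ^ l)) + b x"
    using assms(2) by (auto simp: DO_plus_additive_def)
  have "additive (\<lambda>x. a x + b x)"
    using f(1) g(1) by (simp add: additive_def)
  moreover have "f x + g x =
      (\<Sum>l<CARD('n). \<Sum>k<l. (c k l + d k l) * x ^ (2 ^ k + 2 ^ l)) + (a x + b x)" for x
    by (simp add: f(2) g(2) distrib_right sum.distrib)
  ultimately show ?thesis
    unfolding DO_plus_additive_def
    by (intro exI[of _ "\<lambda>k l. c k l + d k l"] exI[of _ "\<lambda>x. a x + b x"]) simp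
qed

lemma DO_plus_additive_sum:
  assumes "\<And>i. i \<in> A \<Longrightarrow> DO_plus_additive (f i)"
  shows "DO_plus_additive (\<lambda>x. \<Sum>i\<in>A. f i x)"
  using assms
proof (induction A rule: infinite_finite_induct)
  case (insert i A)
  then show ?case by (simp add: DO_plus_additive_add)
qed (simp_all add: DO_plus_additive_additive additive_def)

text \<open>Both factors are linearized polynomials. In their product the terms (k, l) and (l, k)
  share an exponent, and the diagonal terms have exponent 2 ^ Suc k, hence are additive.\<close>

lemma DO_plus_additive_mult:
  assumes "additive f" "additive g"
  shows "DO_plus_additive (\<lambda>x. f x * g x)"
proof -
  obtain a where f: "\<And>x. f x = (\<Sum>i<CARD('n). a i * x ^ 2 ^ i)"
    using additive_imp_linearized[OF assms(1)] by blast
  obtain b where g: "\<And>x. g x = (\<Sum>i<CARD('n). b i * x ^ 2 ^ i)"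
    using additive_imp_linearized[OF assms(2)] by blast
  have "f x * g x = (\<Sum>l<CARD('n). \<Sum>k<l. (a k * b l + a l * b k) * x ^ (2 ^ k + 2 ^ l)) +
      (\<Sum>k<CARD('n). a k * b k * x ^ 2 ^ Suc k)" for x
    unfolding f g sum_product sum_square_split
    by (intro arg_cong2[where f = "(+)"] sum.cong refl) (simp_all add: algebra_simps power_add mult_2_right power_mult power2_eq_square)
  moreover have "additive (\<lambda>x. \<Sum>k<CARD('n). a k * b k * x ^ 2 ^ Suc k)"
    by (intro additive_sum additive_power2_power field_add_self)
  ultimately show ?thesis
    unfolding DO_plus_additive_def
    by (intro exI[of _ "\<lambda>k l. a k * b l + a l * b k"] exI conjI) auto
qed

lemma additive_coord:
  fixes c :: 'k
  shows "additive (\<lambda>x. F2_scale (to_coords \<xi> x $ i) 1 * c)"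
  by (simp add: additive_def additive.add[OF additive_to_coords] F2_scale_add[OF field_add_self] distrib_right)

text \<open>The coordinates \<open>l i\<close>, read as field elements 0 and 1, are additive. The
  expansion along the basis is therefore a sum of additive maps and of products of two additive
  maps.\<close>

lemma third_diff_zero_imp_DO_plus_additive:
  fixes f :: "'k \<Rightarrow> 'k"
  assumes f: "third_diff_zero f" and f0: "f 0 = 0"
  shows "DO_plus_additive f"
proof -
  define B where "B x y = f (x + y) + f x + f y" for x y
  define l where "l i x = F2_scale (to_coords \<xi> x $ i) (1 :: 'k)" for i x
  have l: "l i x = 0 \<or> l i x = 1" for i x
    by (simp add: l_def F2_scale_def)
  have x: "x = (\<Sum>i\<in>UNIV. l i x * \<xi> i)" for x
    using from_coords_to_coords[of x] unfolding from_coords_def l_def by (simp flip: F2_scale_mult)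
  have "f x = (\<Sum>i\<in>UNIV. l i x * f (\<xi> i) + (\<Sum>j | j < i. (l j x * B (\<xi> j) (\<xi> i)) * (l i x * 1)))" for x
  proof -
    have "f x = f (\<Sum>i\<in>UNIV. l i x * \<xi> i)"
      using x by metis
    also have "\<dots> = (\<Sum>i\<in>UNIV. f (l i x * \<xi> i) + (\<Sum>j | j \<in> UNIV \<and> j < i. B (l j x * \<xi> j) (l i x * \<xi> i)))"
      unfolding B_def by (intro third_diff_zero_expansion field_add_self f f0) simp
    also have "\<dots> = (\<Sum>i\<in>UNIV. l i x * f (\<xi> i) + (\<Sum>j | j < i. (l j x * B (\<xi> j) (\<xi> i)) * (l i x * 1)))"
    proof (intro sum.cong refl arg_cong2[where f = "(+)"])
      fix i j
      show "f (l i x * \<xi> i) = l i x * f (\<xi> i)"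
        using l[of i x] by (auto simp: f0)
      show "B (l j x * \<xi> j) (l i x * \<xi> i) = (l j x * B (\<xi> j) (\<xi> i)) * (l i x * 1)"
        using l[of i x] l[of j x] by (auto simp: f0 B_def field_add_self)
    qed simp
    finally show ?thesis .
  qed
  then have "f = (\<lambda>x. \<Sum>i\<in>UNIV. l i x * f (\<xi> i) + (\<Sum>j | j < i. (l j x * B (\<xi> j) (\<xi> i)) * (l i x * 1)))"
    by (rule ext)
  moreover have "DO_plus_additive (\<lambda>x. \<Sum>i\<in>UNIV. l i x * f (\<xi> i) +
      (\<Sum>j | j < i. (l j x * B (\<xi> j) (\<xi> i)) * (l i x * 1)))"
    unfolding l_def
    by (intro DO_plus_additive_sum DO_plus_additive_add DO_plus_additive_mult
        DO_plus_additive_additive additive_coord)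
  ultimately show ?thesis by (rule ssubst[where P = DO_plus_additive])
qed

text \<open>The function of p is that of q + r, with exponents 2 ^ k + 2 ^ l in q and 2 ^ i in r.
  Since p has no coefficients at powers of two, r must vanish. Without \<open>lin\<close> the
  polynomial x would be a counterexample: it is additive, but 1 is not a sum of two powers of
  two.\<close>

lemma Dembowski_Ostrom_iff_third_diff_zero:
  fixes p :: "'k poly"
  assumes deg: "degree p < CARD('k)" and p0: "poly p 0 = 0" and lin: "\<And>i. coeff p (2 ^ i) = 0"
  shows "Dembowski_Ostrom p \<longleftrightarrow> third_diff_zero (poly p)"
proof
  let ?n = "CARD('n)"
  assume "third_diff_zero (poly p)"
  then have "DO_plus_additive (poly p)"
    using p0 by (rule third_diff_zero_imp_DO_plus_additive)
  then obtain c g where "additive g"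
    and "\<And>x. poly p x = (\<Sum>l<?n. \<Sum>k<l. c k l * x ^ (2 ^ k + 2 ^ l)) + g x"
    unfolding DO_plus_additive_def by blast
  moreover obtain a where "\<And>x. g x = (\<Sum>i<?n. a i * x ^ 2 ^ i)"
    using additive_imp_linearized[OF \<open>additive g\<close>] by blast
  ultimately have *: "\<And>x. poly p x =
      (\<Sum>l<?n. \<Sum>k<l. c k l * x ^ (2 ^ k + 2 ^ l)) + (\<Sum>i<?n. a i * x ^ 2 ^ i)"
    by simp
  define q where "q = (\<Sum>l<?n. \<Sum>k<l. monom (c k l) (2 ^ k + 2 ^ l))"
  define r where "r = (\<Sum>i<?n. monom (a i) (2 ^ i))"
  have less: "2 ^ k + 2 ^ l < (2 :: nat) ^ Suc l" if "k < l" for k l :: nat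
    using that by simp
  have "degree (monom (c k l) (2 ^ k + 2 ^ l)) \<le> 2 ^ ?n - 1" if "l < ?n" "k < l" for k l
  proof -
    have "degree (monom (c k l) (2 ^ k + 2 ^ l)) \<le> 2 ^ k + 2 ^ l"
      by (rule degree_monom_le)
    also have "\<dots> < 2 ^ Suc l" by (rule less) fact
    also have "(2 :: nat) ^ Suc l \<le> 2 ^ ?n"
      using \<open>l < ?n\<close> by (intro power_increasing) auto
    finally show ?thesis by linarith
  qed
  then have "degree q \<le> 2 ^ ?n - 1"
    unfolding q_def by (intro degree_sum_le finite_lessThan) (simp_all only: lessThan_iff)
  moreover have "degree (monom (a i) (2 ^ i)) \<le> 2 ^ ?n - 1" if "i < ?n" for i
  proof -
    have "degree (monom (a i) (2 ^ i)) \<le> 2 ^ i"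
      by (rule degree_monom_le)
    also have "\<dots> < (2 :: nat) ^ ?n"
      using that by simp
    finally show ?thesis by linarith
  qed
  then have "degree r \<le> 2 ^ ?n - 1"
    unfolding r_def by (intro degree_sum_le finite_lessThan) (simp_all only: lessThan_iff)
  ultimately have "degree (q + r) \<le> 2 ^ ?n - 1"
    by (rule degree_add_le)
  then have "degree (q + r) < 2 ^ ?n"
    by (rule order_le_less_trans) simp
  \<comment> \<open>Both degrees are below the number of field elements, so equality of functions is
    equality of polynomials.\<close>
  then have p: "p = q + r"
    using deg * by (intro poly_eqI_degree[where A = "UNIV :: 'k set"])
      (simp_all add: card_field q_def r_def poly_sum poly_monom)
  have "a i = 0" if "i < ?n" for i
  proof -
    \<comment> \<open>The sum lies strictly between 2 ^ l and 2 ^ Suc l.\<close>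
    have "2 ^ k + 2 ^ l \<noteq> (2 :: nat) ^ i" if "k < l" for k l
    proof
      assume eq: "2 ^ k + 2 ^ l = (2 :: nat) ^ i"
      have "(2 :: nat) ^ l < 2 ^ i"
        unfolding eq[symmetric] by simp
      then have "l < i"
        by (rule power_less_imp_less_exp[rotated]) simp
      have "(2 :: nat) ^ i < 2 ^ Suc l"
        unfolding eq[symmetric] by (rule less[OF that])
      then have "i < Suc l"
        by (rule power_less_imp_less_exp[rotated]) simp
      with \<open>l < i\<close> show False by simp
    qed
    then have "coeff q (2 ^ i) = 0"
      by (auto simp: q_def coeff_sum intro!: sum.neutral)
    moreover have "coeff r (2 ^ i) = a i"
      using that by (simp add: r_def coeff_sum)
    ultimately show ?thesis
      using lin[of i] by (simp add: p)
  qed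
  then have "r = 0"
    by (simp add: r_def)
  have "q = (\<Sum>i<?n. \<Sum>j<?n. monom (if j < i then c j i else 0) (2 ^ i + 2 ^ j))"
    unfolding q_def
    by (intro sum.cong refl sum.mono_neutral_cong_left) (auto simp: add.commute)
  then show "Dembowski_Ostrom p"
    unfolding Dembowski_Ostrom_def p \<open>r = 0\<close>
    by (intro exI[of _ ?n] exI[of _ "\<lambda>i j. if j < i then c j i else 0"]) simp
qed (rule third_diff_zero_Dembowski_Ostrom[OF field_add_self])

lemma third_diff_zero_basis_mu: "third_diff_zero (basis_mu \<xi>)"
proof -
  have "basis_mu \<xi> = (\<lambda>x. \<Sum>(i, j) | i < j.
      (F2_scale (to_coords \<xi> x $ i) 1 * (\<xi> i * \<xi> j)) * (F2_scale (to_coords \<xi> x $ j) 1 * 1))"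
    unfolding basis_mu_def by (intro ext sum.cong refl) (auto simp: F2_scale_def)
  moreover have "third_diff_zero (\<lambda>x. \<Sum>(i, j) | i < j.
      (F2_scale (to_coords \<xi> x $ i) 1 * (\<xi> i * \<xi> j)) * (F2_scale (to_coords \<xi> x $ j) 1 * 1))"
    by (intro third_diff_zero_sum) (auto intro!: third_diff_zero_mult field_add_self additive_coord simp del: mult_1_right)
  ultimately show ?thesis by (rule ssubst[where P = third_diff_zero])
qed

lemma additive_square: "additive (\<lambda>x :: 'k. x ^ 2)"
  using power2_power_add[OF field_add_self, of _ _ 1] by (simp add: additive_def)

lemma inj_square: "inj (\<lambda>x :: 'k. x ^ 2)"
proof (rule injI)
  fix x y :: 'k assume "x ^ 2 = y ^ 2"
  then have "(x - y) ^ 2 = 0"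
    by (simp add: additive.diff[OF additive_square])
  then show "x = y" by simp
qed

text \<open>Each layer between \<open>h\<close> and the polynomial respects vanishing third
  differences: the coordinate maps are additive bijections, squaring is additive and injective,
  adding \<open>basis_mu\<close> twice changes nothing, and each normalization removes an additive
  map and a constant.\<close>

lemma Dembowski_Ostrom_normalized_field_rep_iff:
  fixes D :: "(4, 'n) vec set" and h a :: "(bit, 'n) vec \<Rightarrow> (bit, 'n) vec"
  assumes a: "additive a" and h: "\<And>x. F2_rep D x = h x + a x + k" and h0: "h 0 = 0"
  shows "Dembowski_Ostrom (normalized_field_rep \<xi> D) \<longleftrightarrow> third_diff_zero h"
proof -
  let ?p = "normalized_field_rep \<xi> D" and ?f = "field_rep \<xi> D"
  note add = additive.add[OF additive_from_coords[OF field_add_self, of \<xi>]]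
  note sq = additive.add[OF additive_square]
  obtain b where b1: "additive b"
    and b2: "\<And>x. poly (reduced_poly ?f) x = poly ?p x + b x + poly (reduced_poly ?f) 0"
    using poly_remove_linearized_terms[OF field_add_self, of "reduced_poly ?f"]
    unfolding normalized_field_rep_def by auto
  have p0: "poly ?p 0 = 0"
    by (simp only: poly_0_coeff_0 normalized_field_rep_def coeff_remove_linearized_terms) simp
  have tc0: "to_coords \<xi> 0 = 0"
    by (rule additive.zero[OF additive_to_coords])
  have mu0: "basis_mu \<xi> 0 = 0"
    by (simp add: basis_mu_def tc0 F2_scale_def)
  let ?g = "\<lambda>x. (from_coords \<xi> (h (to_coords \<xi> x)))\<^sup>2"
  let ?c = "\<lambda>x. (from_coords \<xi> (a (to_coords \<xi> x)))\<^sup>2"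
  have c: "additive ?c"
    by (simp only: additive_def additive.add[OF additive_to_coords] additive.add[OF a] add sq) simp
  have f: "?f x = ?g x + ?c x + (from_coords \<xi> k)\<^sup>2 + basis_mu \<xi> x" for x
    by (simp only: field_rep_def h add sq)
  have from0: "from_coords \<xi> 0 = 0"
    by (rule additive.zero[OF additive_from_coords[OF field_add_self]])
  have f0: "?f 0 = (from_coords \<xi> k)\<^sup>2"
    by (simp only: f mu0 tc0 h0 additive.zero[OF a] from0) simp
  have bc: "additive (\<lambda>x. ?c x - b x)"
    using c b1 by (simp add: additive_def algebra_simps)
  \<comment> \<open>The constants cancel, because the value of \<open>?f\<close> at 0 is the square
    of the image of k. What is left over is the difference of the additive parts removed over F_2
    and over the field.\<close>
  have "poly ?p x = (?g x + basis_mu \<xi> x) + (?c x - b x)" for x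
    using b2[of x] unfolding reduced_poly(2) f0 f[of x] by (simp add: algebra_simps)
  then have "third_diff_zero (poly ?p) \<longleftrightarrow> third_diff_zero (\<lambda>x. ?g x + basis_mu \<xi> x)"
    by (rule third_diff_zero_cong_additive[OF field_add_self bc])
  also have "\<dots> \<longleftrightarrow> third_diff_zero ?g"
  proof
    assume "third_diff_zero (\<lambda>x. ?g x + basis_mu \<xi> x)"
    from third_diff_zero_add[OF this third_diff_zero_basis_mu]
    show "third_diff_zero ?g" by (simp only: add.assoc field_add_self add_0_right)
  qed (rule third_diff_zero_add[OF _ third_diff_zero_basis_mu])
  also have "\<dots> \<longleftrightarrow> third_diff_zero h"
  proof (rule third_diff_zero_comp_iff[where a = "\<lambda>y. (from_coords \<xi> y)\<^sup>2" and b = "to_coords \<xi>"])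
    show "additive (\<lambda>y. (from_coords \<xi> y)\<^sup>2)"
      by (simp add: additive_def add sq)
    show "inj (\<lambda>y. (from_coords \<xi> y)\<^sup>2)"
      using inj_compose[OF inj_square bij_is_inj[OF bij_from_coords]] unfolding o_def .
    show "surj (to_coords \<xi>)"
      by (metis surjI to_coords_from_coords)
  qed (rule additive_to_coords)
  finally show ?thesis
  proof (subst Dembowski_Ostrom_iff_third_diff_zero[OF _ p0])
    show "degree ?p < CARD('k)"
      unfolding normalized_field_rep_def
      by (rule order_le_less_trans[OF degree_remove_linearized_terms reduced_poly(1)])
    show "coeff ?p (2 ^ i) = 0" for i
      by (simp add: normalized_field_rep_def coeff_remove_linearized_terms)
  qed
qed

end

subsection \<open>Isomorphisms of incidence structures\<close>

text \<open>\<open>isomorphic\<close> with its two maps made explicit, so that collineations can be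
  composed, inverted and evaluated.\<close>

definition isomorphism ::
    "('p \<Rightarrow> 'q) \<Rightarrow> ('l \<Rightarrow> 'k) \<Rightarrow> ('p, 'l) incidence_structure \<Rightarrow> ('q, 'k) incidence_structure \<Rightarrow> bool" where
  "isomorphism \<alpha> \<beta> P R \<longleftrightarrow>
     bij_betw \<alpha> (points P) (points R) \<and> bij_betw \<beta> (lines P) (lines R) \<and>
     (\<forall>p\<in>points P. \<forall>l\<in>lines P. incident P p l \<longleftrightarrow> incident R (\<alpha> p) (\<beta> l))"

lemma isomorphic_iff: "isomorphic P R \<longleftrightarrow> (\<exists>\<alpha> \<beta>. isomorphism \<alpha> \<beta> P R)"
  by (simp add: isomorphic_def isomorphism_def)

lemma isomorphismD:
  assumes "isomorphism \<alpha> \<beta> P R" "p \<in> points P" "l \<in> lines P"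
  shows "\<alpha> p \<in> points R" "\<beta> l \<in> lines R" "incident R (\<alpha> p) (\<beta> l) \<longleftrightarrow> incident P p l"
  using assms by (auto simp: isomorphism_def bij_betw_apply)

lemma isomorphism_comp:
  assumes "isomorphism \<alpha> \<beta> P Q" "isomorphism \<gamma> \<delta> Q R"
  shows "isomorphism (\<gamma> \<circ> \<alpha>) (\<delta> \<circ> \<beta>) P R"
  using assms by (auto simp: isomorphism_def bij_betw_apply intro: bij_betw_trans)

lemma isomorphism_inv:
  assumes "isomorphism \<alpha> \<beta> P R"
  shows "isomorphism (inv_into (points P) \<alpha>) (inv_into (lines P) \<beta>) R P"
proof -
  have \<alpha>: "bij_betw \<alpha> (points P) (points R)" and \<beta>: "bij_betw \<beta> (lines P) (lines R)"
    and inc: "\<And>p l. p \<in> points P \<Longrightarrow> l \<in> lines P \<Longrightarrow> incident P p l \<longleftrightarrow> incident R (\<alpha> p) (\<beta> l)"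
    using assms by (auto simp: isomorphism_def)
  note \<alpha>' = bij_betw_inv_into[OF \<alpha>] and \<beta>' = bij_betw_inv_into[OF \<beta>]
  have "incident R p l \<longleftrightarrow> incident P (inv_into (points P) \<alpha> p) (inv_into (lines P) \<beta> l)"
    if "p \<in> points R" "l \<in> lines R" for p l
    using inc[OF bij_betw_apply[OF \<alpha>' that(1)] bij_betw_apply[OF \<beta>' that(2)]]
    by (simp add: bij_betw_inv_into_right[OF \<alpha> that(1)] bij_betw_inv_into_right[OF \<beta> that(2)])
  then show ?thesis
    using \<alpha>' \<beta>' by (simp add: isomorphism_def)
qed

lemma isomorphic_sym: "isomorphic P R \<Longrightarrow> isomorphic R P"
  using isomorphism_inv by (fastforce simp: isomorphic_iff)

lemma isomorphic_trans: "isomorphic P Q \<Longrightarrow> isomorphic Q R \<Longrightarrow> isomorphic P R"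
  using isomorphism_comp by (fastforce simp: isomorphic_iff)

lemma projective_plane_join:
  assumes "projective_plane P" "p \<in> points P" "q \<in> points P" "p \<noteq> q"
  shows "\<exists>!l. l \<in> lines P \<and> incident P p l \<and> incident P q l"
  using assms by (simp add: projective_plane_def)

lemma projective_plane_meet:
  assumes "projective_plane P" "k \<in> lines P" "l \<in> lines P" "k \<noteq> l"
  shows "\<exists>!p. p \<in> points P \<and> incident P p k \<and> incident P p l"
  using assms by (simp add: projective_plane_def)

lemma projective_plane_isomorphic:
  assumes "isomorphic P R" "projective_plane P"
  shows "projective_plane R"
proof -
  obtain \<alpha> \<beta> where "isomorphism \<alpha> \<beta> P R"
    using assms(1) by (auto simp: isomorphic_iff)
  then have \<alpha>: "bij_betw \<alpha> (points P) (points R)" and \<beta>: "bij_betw \<beta> (lines P) (lines R)"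
    and inc: "\<And>p l. p \<in> points P \<Longrightarrow> l \<in> lines P \<Longrightarrow> incident R (\<alpha> p) (\<beta> l) \<longleftrightarrow> incident P p l"
    by (auto simp: isomorphism_def)
  have R: "points R = \<alpha> ` points P" "lines R = \<beta> ` lines P"
    using \<alpha> \<beta> by (auto simp: bij_betw_def)
  have inj: "\<alpha> p = \<alpha> q \<longleftrightarrow> p = q" if "p \<in> points P" "q \<in> points P" for p q
    using \<alpha> that by (auto simp: bij_betw_def inj_on_def)
  have inj': "\<beta> k = \<beta> l \<longleftrightarrow> k = l" if "k \<in> lines P" "l \<in> lines P" for k l
    using \<beta> that by (auto simp: bij_betw_def inj_on_def)
  show ?thesis
    unfolding projective_plane_def R
  proof (intro conjI)
    show "\<forall>p\<in>\<alpha> ` points P. \<forall>q\<in>\<alpha> ` points P. p \<noteq> q \<longrightarrow>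
        (\<exists>!l. l \<in> \<beta> ` lines P \<and> incident R p l \<and> incident R q l)"
    proof clarify
      fix p q assume pq: "p \<in> points P" "q \<in> points P" "\<alpha> p \<noteq> \<alpha> q"
      then have "\<exists>!l. l \<in> lines P \<and> incident P p l \<and> incident P q l"
        by (intro projective_plane_join[OF assms(2)]) auto
      then obtain l where l: "l \<in> lines P" "incident P p l" "incident P q l"
        and uniq: "\<And>k. k \<in> lines P \<Longrightarrow> incident P p k \<Longrightarrow> incident P q k \<Longrightarrow> k = l"
        by blast
      show "\<exists>!l. l \<in> \<beta> ` lines P \<and> incident R (\<alpha> p) l \<and> incident R (\<alpha> q) l"
      proof (rule ex1I)
        show "\<beta> l \<in> \<beta> ` lines P \<and> incident R (\<alpha> p) (\<beta> l) \<and> incident R (\<alpha> q) (\<beta> l)"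
          using l pq by (simp add: inc)
        fix k' assume k': "k' \<in> \<beta> ` lines P \<and> incident R (\<alpha> p) k' \<and> incident R (\<alpha> q) k'"
        then obtain k where "k \<in> lines P" "k' = \<beta> k" by blast
        then show "k' = \<beta> l"
          using k' pq uniq[of k] by (simp add: inc)
      qed
    qed
    show "\<forall>k\<in>\<beta> ` lines P. \<forall>l\<in>\<beta> ` lines P. k \<noteq> l \<longrightarrow>
        (\<exists>!p. p \<in> \<alpha> ` points P \<and> incident R p k \<and> incident R p l)"
    proof clarify
      fix k l assume kl: "k \<in> lines P" "l \<in> lines P" "\<beta> k \<noteq> \<beta> l"
      then have "\<exists>!p. p \<in> points P \<and> incident P p k \<and> incident P p l"
        by (intro projective_plane_meet[OF assms(2)]) auto
      then obtain p where p: "p \<in> points P" "incident P p k" "incident P p l"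
        and uniq: "\<And>q. q \<in> points P \<Longrightarrow> incident P q k \<Longrightarrow> incident P q l \<Longrightarrow> q = p"
        by blast
      show "\<exists>!p. p \<in> \<alpha> ` points P \<and> incident R p (\<beta> k) \<and> incident R p (\<beta> l)"
      proof (rule ex1I)
        show "\<alpha> p \<in> \<alpha> ` points P \<and> incident R (\<alpha> p) (\<beta> k) \<and> incident R (\<alpha> p) (\<beta> l)"
          using p kl by (simp add: inc)
        fix q' assume q': "q' \<in> \<alpha> ` points P \<and> incident R q' (\<beta> k) \<and> incident R q' (\<beta> l)"
        then obtain q where "q \<in> points P" "q' = \<alpha> q" by blast
        then show "q' = \<alpha> p"
          using q' kl uniq[of q] by (simp add: inc)
      qed
    qed
    obtain Q where Q: "Q \<subseteq> points P" "card Q = 4"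
        "\<And>l. l \<in> lines P \<Longrightarrow> card {p \<in> Q. incident P p l} \<le> 2"
      using assms(2) by (auto simp: projective_plane_def)
    have "finite Q"
      using Q(2) by (simp add: card_ge_0_finite)
    show "\<exists>Q\<subseteq>\<alpha> ` points P. card Q = 4 \<and> (\<forall>l\<in>\<beta> ` lines P. card {p \<in> Q. incident R p l} \<le> 2)"
    proof (intro exI[of _ "\<alpha> ` Q"] conjI ballI)
      show "\<alpha> ` Q \<subseteq> \<alpha> ` points P"
        using Q(1) by blast
      have "inj_on \<alpha> Q"
        using \<alpha> Q(1) by (auto simp: bij_betw_def intro: inj_on_subset)
      then show "card (\<alpha> ` Q) = 4"
        using Q(2) by (simp add: card_image)
      fix l assume "l \<in> \<beta> ` lines P"
      then obtain k where k: "k \<in> lines P" "l = \<beta> k" by blast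
      have "{p \<in> \<alpha> ` Q. incident R p l} = \<alpha> ` {p \<in> Q. incident P p k}"
        using Q(1) k inc by auto
      then have "card {p \<in> \<alpha> ` Q. incident R p l} \<le> card {p \<in> Q. incident P p k}"
        using \<open>finite Q\<close> by (simp add: card_image_le)
      with Q(3)[OF k(1)] show "card {p \<in> \<alpha> ` Q. incident R p l} \<le> 2"
        by linarith
    qed
  qed
qed

subsection \<open>Translation lines\<close>

text \<open>This is (c, l)-transitivity for every centre c on the axis l: the elations with this
  centre and axis act transitively on the points off l of each line through c. That c is the centre
  is expressed by \<open>\<beta>\<close> fixing all lines through c.\<close>

definition translation_line :: "('p, 'l) incidence_structure \<Rightarrow> 'l \<Rightarrow> bool" where
  "translation_line P l \<longleftrightarrow> l \<in> lines P \<and>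
     (\<forall>c\<in>points P. \<forall>p\<in>points P. \<forall>q\<in>points P. \<forall>m\<in>lines P.
        incident P c l \<and> \<not> incident P p l \<and> \<not> incident P q l \<and>
        incident P c m \<and> incident P p m \<and> incident P q m \<longrightarrow>
        (\<exists>\<alpha> \<beta>. isomorphism \<alpha> \<beta> P P \<and> \<alpha> p = q \<and>
           (\<forall>r\<in>points P. incident P r l \<longrightarrow> \<alpha> r = r) \<and>
           (\<forall>k\<in>lines P. incident P c k \<longrightarrow> \<beta> k = k)))"

lemma translation_lineE:
  assumes "translation_line P l" "c \<in> points P" "p \<in> points P" "q \<in> points P" "m \<in> lines P"
    and "incident P c l" "\<not> incident P p l" "\<not> incident P q l"
    and "incident P c m" "incident P p m" "incident P q m"
  obtains \<alpha> \<beta> where "isomorphism \<alpha> \<beta> P P" "\<alpha> p = q"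
    "\<And>r. r \<in> points P \<Longrightarrow> incident P r l \<Longrightarrow> \<alpha> r = r"
    "\<And>k. k \<in> lines P \<Longrightarrow> incident P c k \<Longrightarrow> \<beta> k = k"
proof -
  have "\<exists>\<alpha> \<beta>. isomorphism \<alpha> \<beta> P P \<and> \<alpha> p = q \<and>
      (\<forall>r\<in>points P. incident P r l \<longrightarrow> \<alpha> r = r) \<and>
      (\<forall>k\<in>lines P. incident P c k \<longrightarrow> \<beta> k = k)"
    using assms(1)[unfolded translation_line_def, THEN conjunct2, rule_format, OF assms(2-5)]
      assms(6-) by simp
  then show ?thesis
    by (elim exE conjE) (rule that, assumption, assumption, blast, blast)
qed

text \<open>Elations are conjugated by the isomorphism. For P = R this says that collineations
  permute the translation lines.\<close>

lemma translation_line_isomorphism: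
  assumes iso: "isomorphism \<gamma> \<delta> P R" and l: "translation_line P l"
  shows "translation_line R (\<delta> l)"
  unfolding translation_line_def
proof (intro conjI ballI impI)
  have \<gamma>: "bij_betw \<gamma> (points P) (points R)" and \<delta>: "bij_betw \<delta> (lines P) (lines R)"
    and inc: "\<And>p l. p \<in> points P \<Longrightarrow> l \<in> lines P \<Longrightarrow> incident R (\<gamma> p) (\<delta> l) \<longleftrightarrow> incident P p l"
    using iso by (auto simp: isomorphism_def)
  have lP: "l \<in> lines P"
    using l by (simp add: translation_line_def)
  then show "\<delta> l \<in> lines R"
    using \<delta> by (auto simp: bij_betw_def)
  fix c' p' q' m'
  have preimage: "\<exists>r. r \<in> points P \<and> r' = \<gamma> r" if "r' \<in> points R" for r'
    using that bij_betw_imp_surj_on[OF \<gamma>] by blast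
  have preimage': "\<exists>k. k \<in> lines P \<and> k' = \<delta> k" if "k' \<in> lines R" for k'
    using that bij_betw_imp_surj_on[OF \<delta>] by blast
  assume R: "c' \<in> points R" "p' \<in> points R" "q' \<in> points R" "m' \<in> lines R"
  obtain c where c: "c \<in> points P" "c' = \<gamma> c" using preimage[OF R(1)] by blast
  obtain p where p: "p \<in> points P" "p' = \<gamma> p" using preimage[OF R(2)] by blast
  obtain q where q: "q \<in> points P" "q' = \<gamma> q" using preimage[OF R(3)] by blast
  obtain m where m: "m \<in> lines P" "m' = \<delta> m" using preimage'[OF R(4)] by blast
  note P = c(1) p(1) q(1) m(1) and eq = c(2) p(2) q(2) m(2)
  assume "incident R c' (\<delta> l) \<and> \<not> incident R p' (\<delta> l) \<and> \<not> incident R q' (\<delta> l) \<and>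
    incident R c' m' \<and> incident R p' m' \<and> incident R q' m'"
  then have *: "incident P c l" "\<not> incident P p l" "\<not> incident P q l"
      "incident P c m" "incident P p m" "incident P q m"
    using P lP by (simp_all add: eq inc)
  obtain \<alpha> \<beta> where \<alpha>\<beta>: "isomorphism \<alpha> \<beta> P P" "\<alpha> p = q"
      "\<And>r. r \<in> points P \<Longrightarrow> incident P r l \<Longrightarrow> \<alpha> r = r"
      "\<And>k. k \<in> lines P \<Longrightarrow> incident P c k \<Longrightarrow> \<beta> k = k"
    by (rule translation_lineE[OF l P *]) (rule that, assumption+)
  let ?\<gamma> = "inv_into (points P) \<gamma>" and ?\<delta> = "inv_into (lines P) \<delta>"
  have inv: "?\<gamma> (\<gamma> r) = r" if "r \<in> points P" for r
    using \<gamma> that by (rule bij_betw_inv_into_left)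
  have inv': "?\<delta> (\<delta> k) = k" if "k \<in> lines P" for k
    using \<delta> that by (simp add: bij_betw_inv_into_left)
  show "\<exists>\<alpha> \<beta>. isomorphism \<alpha> \<beta> R R \<and> \<alpha> p' = q' \<and>
      (\<forall>r\<in>points R. incident R r (\<delta> l) \<longrightarrow> \<alpha> r = r) \<and>
      (\<forall>k\<in>lines R. incident R c' k \<longrightarrow> \<beta> k = k)"
  proof (intro exI conjI ballI impI)
    show "isomorphism ((\<gamma> \<circ> \<alpha>) \<circ> ?\<gamma>) ((\<delta> \<circ> \<beta>) \<circ> ?\<delta>) R R"
      by (intro isomorphism_comp[OF isomorphism_inv[OF iso]] isomorphism_comp[OF \<alpha>\<beta>(1) iso])
    show "((\<gamma> \<circ> \<alpha>) \<circ> ?\<gamma>) p' = q'"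
      by (simp add: eq inv P \<alpha>\<beta>(2))
    show "((\<gamma> \<circ> \<alpha>) \<circ> ?\<gamma>) r' = r'" if r': "r' \<in> points R" "incident R r' (\<delta> l)" for r'
    proof -
      obtain r where "r \<in> points P" "r' = \<gamma> r"
        using preimage[OF r'(1)] by blast
      then show ?thesis
        using r'(2) lP by (simp add: inc inv \<alpha>\<beta>(3))
    qed
    show "((\<delta> \<circ> \<beta>) \<circ> ?\<delta>) k' = k'" if k': "k' \<in> lines R" "incident R c' k'" for k'
    proof -
      obtain k where "k \<in> lines P" "k' = \<delta> k"
        using preimage'[OF k'(1)] by blast
      then show ?thesis
        using k'(2) P by (simp add: eq inc inv' \<alpha>\<beta>(4))
    qed
  qed
qed

lemma projective_plane_join_unique:
  assumes "projective_plane P" "p \<in> points P" "q \<in> points P" "p \<noteq> q"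
    and "k \<in> lines P" "incident P p k" "incident P q k"
    and "l \<in> lines P" "incident P p l" "incident P q l"
  shows "k = l"
  using projective_plane_join[OF assms(1-4)] assms(5-) by blast

text \<open>A translation with axis \<open>l\<^sub>1\<close> maps \<open>l\<^sub>2\<close> to \<open>l\<^sub>3\<close>.\<close>

lemma translation_line_pencil:
  assumes P: "projective_plane P" and l1: "translation_line P l1" and l2: "translation_line P l2"
    and l3: "l3 \<in> lines P" and "l1 \<noteq> l2"
    and v: "v \<in> points P" "incident P v l1" "incident P v l2" "incident P v l3"
    and thick: "\<And>l. l \<in> lines P \<Longrightarrow> \<exists>r\<in>points P. incident P r l \<and> r \<noteq> v"
  shows "translation_line P l3"
proof (cases "l3 = l1 \<or> l3 = l2")
  case True
  then show ?thesis using l1 l2 by blast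
next
  case False
  have lines: "l1 \<in> lines P" "l2 \<in> lines P"
    using l1 l2 by (auto simp: translation_line_def)
  note join = projective_plane_join_unique[OF P]
  obtain p where p: "p \<in> points P" "incident P p l2" "p \<noteq> v"
    using thick[OF lines(2)] by blast
  obtain q where q: "q \<in> points P" "incident P q l3" "q \<noteq> v"
    using thick[OF l3] by blast
  have p1: "\<not> incident P p l1"
    using join[OF p(1) v(1) p(3) lines(1) _ v(2) lines(2) p(2) v(3)] \<open>l1 \<noteq> l2\<close> by blast
  have q1: "\<not> incident P q l1"
    using join[OF q(1) v(1) q(3) lines(1) _ v(2) l3 q(2) v(4)] False by blast
  have "p \<noteq> q"
    using join[OF p(1) v(1) p(3) lines(2) p(2) v(3) l3 _ v(4)] q(2) False by blast
  then obtain m where m: "m \<in> lines P" "incident P p m" "incident P q m"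
    using projective_plane_join[OF P p(1) q(1)] by blast
  \<comment> \<open>The line m through p and q meets the axis in the required centre c. The elation
    taking p to q fixes v on the axis, so it takes the line pv, which is l2, to the line qv, which
    is l3.\<close>
  have "m \<noteq> l1" using m p1 by blast
  then obtain c where c: "c \<in> points P" "incident P c m" "incident P c l1"
    using projective_plane_meet[OF P m(1) lines(1)] by blast
  obtain \<alpha> \<beta> where \<alpha>\<beta>: "isomorphism \<alpha> \<beta> P P" "\<alpha> p = q"
      "\<And>r. r \<in> points P \<Longrightarrow> incident P r l1 \<Longrightarrow> \<alpha> r = r"
      "\<And>k. k \<in> lines P \<Longrightarrow> incident P c k \<Longrightarrow> \<beta> k = k"
    by (rule translation_lineE[OF l1 c(1) p(1) q(1) m(1) c(3) p1 q1 c(2) m(2,3)])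
      (rule that, assumption+)
  have "incident P q (\<beta> l2)" "incident P v (\<beta> l2)"
    using isomorphismD(3)[OF \<alpha>\<beta>(1) p(1) lines(2)] isomorphismD(3)[OF \<alpha>\<beta>(1) v(1) lines(2)]
    by (simp_all only: \<alpha>\<beta>(2) \<alpha>\<beta>(3)[OF v(1,2)] p(2) v(3))
  then have "\<beta> l2 = l3"
    using join[OF q(1) v(1) q(3) isomorphismD(2)[OF \<alpha>\<beta>(1) p(1) lines(2)] _ _ l3 q(2) v(4)] by blast
  then show ?thesis
    using translation_line_isomorphism[OF \<alpha>\<beta>(1) l2] by simp
qed

subsection \<open>Coordinate planes\<close>

lemma coord_plane_simps [simp]:
  "Affine_point x y \<in> points (coord_plane S add mul) \<longleftrightarrow> x \<in> S \<and> y \<in> S"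
  "Slope_point x \<in> points (coord_plane S add mul) \<longleftrightarrow> x \<in> S"
  "Vertical_point \<in> points (coord_plane S add mul)"
  "Sloped_line x y \<in> lines (coord_plane S add mul) \<longleftrightarrow> x \<in> S \<and> y \<in> S"
  "Vertical_line x \<in> lines (coord_plane S add mul) \<longleftrightarrow> x \<in> S"
  "Infinite_line \<in> lines (coord_plane S add mul)"
  "incident (coord_plane S add mul) = coord_incident add mul"
  by (simp_all add: coord_plane_def image_iff)

lemma coord_plane_UNIV [simp]:
  "points (coord_plane UNIV add mul) = UNIV" "lines (coord_plane UNIV add mul) = UNIV"
proof -
  have "p \<in> points (coord_plane UNIV add mul)" for p
    by (cases p; hypsubst) simp_all
  then show "points (coord_plane UNIV add mul) = UNIV"
    by (intro UNIV_eq_I[symmetric])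
  have "l \<in> lines (coord_plane UNIV add mul)" for l
    by (cases l; hypsubst) simp_all
  then show "lines (coord_plane UNIV add mul) = UNIV"
    by (intro UNIV_eq_I[symmetric])
qed

text \<open>The common shape of all isomorphisms between coordinate planes used below. Letting g
  depend on x and t on m admits shears and slope-dependent changes of the intercept.\<close>

lemma isomorphism_coord_plane:
  assumes f: "bij_betw f S T" and g: "\<And>x. x \<in> S \<Longrightarrow> bij_betw (g x) S T"
    and s: "bij_betw s S T" and t: "\<And>m. m \<in> S \<Longrightarrow> bij_betw (t m) S T"
    and inc: "\<And>x y m k. \<lbrakk>x \<in> S; y \<in> S; m \<in> S; k \<in> S\<rbrakk> \<Longrightarrow>
      y = add (mul m x) k \<longleftrightarrow> g x y = add' (mul' (s m) (f x)) (t m k)"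
  shows "isomorphism
    (\<lambda>p. case p of Affine_point x y \<Rightarrow> Affine_point (f x) (g x y)
      | Slope_point m \<Rightarrow> Slope_point (s m) | Vertical_point \<Rightarrow> Vertical_point)
    (\<lambda>l. case l of Sloped_line m k \<Rightarrow> Sloped_line (s m) (t m k)
      | Vertical_line c \<Rightarrow> Vertical_line (f c) | Infinite_line \<Rightarrow> Infinite_line)
    (coord_plane S add mul) (coord_plane T add' mul')"
    (is "isomorphism ?\<alpha> ?\<beta> ?P ?R")
proof -
  have inj: "f x = f y \<longleftrightarrow> x = y" "s x = s y \<longleftrightarrow> x = y" if "x \<in> S" "y \<in> S" for x y
    by (rule inj_on_eq_iff[OF bij_betw_imp_inj_on that], rule f)
      (rule inj_on_eq_iff[OF bij_betw_imp_inj_on that], rule s)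
  have inj': "g z x = g z y \<longleftrightarrow> x = y" "t z x = t z y \<longleftrightarrow> x = y" if "x \<in> S" "y \<in> S" "z \<in> S" for x y z
    by (rule inj_on_eq_iff[OF bij_betw_imp_inj_on that(1,2)], rule g[OF that(3)])
      (rule inj_on_eq_iff[OF bij_betw_imp_inj_on that(1,2)], rule t[OF that(3)])
  have img: "f ` S = T" "s ` S = T" "\<And>x. x \<in> S \<Longrightarrow> g x ` S = T" "\<And>x. x \<in> S \<Longrightarrow> t x ` S = T"
    by (rule bij_betw_imp_surj_on, rule f s g t, assumption?)+
  have mem: "f x \<in> T" "s x \<in> T" if "x \<in> S" for x
    using bij_betw_apply[OF f that] bij_betw_apply[OF s that] by simp_all
  have mem': "g x y \<in> T" "t x y \<in> T" if "x \<in> S" "y \<in> S" for x y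
    using bij_betw_apply[OF g[OF that(1)] that(2)] bij_betw_apply[OF t[OF that(1)] that(2)] by simp_all
  have "bij_betw ?\<alpha> (points ?P) (points ?R)"
  proof (rule bij_betw_imageI)
    show "inj_on ?\<alpha> (points ?P)"
      by (auto simp: inj_on_def coord_plane_def inj inj')
    have "p \<in> ?\<alpha> ` points ?P" if p: "p \<in> points ?R" for p
    proof (cases p)
      case (Affine_point x' y')
      then obtain x y where "x \<in> S" "x' = f x" "y \<in> S" "y' = g x y"
        using img p by (metis coord_plane_simps(1) image_iff)
      then show ?thesis
        using Affine_point by (intro image_eqI[of _ _ "Affine_point x y"]) auto
    next
      case (Slope_point m')
      then obtain m where "m \<in> S" "m' = s m"
        using img p by (metis coord_plane_simps(2) image_iff)
      then show ?thesis
        using Slope_point by (intro image_eqI[of _ _ "Slope_point m"]) auto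
    next
      case Vertical_point
      then show ?thesis by (intro image_eqI[of _ _ Vertical_point]) auto
    qed
    then show "?\<alpha> ` points ?P = points ?R"
      using mem mem' by (auto simp: coord_plane_def)
  qed
  moreover have "bij_betw ?\<beta> (lines ?P) (lines ?R)"
  proof (rule bij_betw_imageI)
    show "inj_on ?\<beta> (lines ?P)"
      by (auto simp: inj_on_def coord_plane_def inj inj')
    have "l \<in> ?\<beta> ` lines ?P" if l: "l \<in> lines ?R" for l
    proof (cases l)
      case (Sloped_line m' k')
      then obtain m k where "m \<in> S" "m' = s m" "k \<in> S" "k' = t m k"
        using img l by (metis coord_plane_simps(4) image_iff)
      then show ?thesis
        using Sloped_line by (intro image_eqI[of _ _ "Sloped_line m k"]) auto
    next
      case (Vertical_line c')
      then obtain c where "c \<in> S" "c' = f c"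
        using img l by (metis coord_plane_simps(5) image_iff)
      then show ?thesis
        using Vertical_line by (intro image_eqI[of _ _ "Vertical_line c"]) auto
    next
      case Infinite_line
      then show ?thesis by (intro image_eqI[of _ _ Infinite_line]) auto
    qed
    then show "?\<beta> ` lines ?P = lines ?R"
      using mem mem' by (auto simp: coord_plane_def)
  qed
  moreover have "incident ?P p l \<longleftrightarrow> incident ?R (?\<alpha> p) (?\<beta> l)"
    if "p \<in> points ?P" "l \<in> lines ?P" for p l
    using that by (cases p; cases l) (simp_all add: inj inc)
  ultimately show ?thesis
    by (simp add: isomorphism_def)
qed

text \<open>Unique solvability of the two difference equations gives joins of affine points with
  different abscissas and meets of lines with different slopes; the remaining cases are read off
  from the incidence rules.\<close>

lemma projective_plane_coord_plane:
  fixes mul :: "'s::ab_group_add \<Rightarrow> 's \<Rightarrow> 's"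
  assumes join: "\<And>x x' d. x \<noteq> x' \<Longrightarrow> \<exists>!m. mul m x - mul m x' = d"
    and meet: "\<And>m m' d. m \<noteq> m' \<Longrightarrow> \<exists>!x. mul m x - mul m' x = d"
    and zero: "\<And>x. mul 0 x = 0" and nontrivial: "(a :: 's) \<noteq> 0"
  shows "projective_plane (coord_plane UNIV (+) mul)"
proof -
  let ?I = "coord_incident (+) mul"
  define J where "J p q \<longleftrightarrow> (\<exists>l. ?I p l \<and> ?I q l)" for p q
  have J_sym: "J p q \<Longrightarrow> J q p" for p q
    unfolding J_def by blast
  have J_aff: "J (Affine_point x y) (Affine_point x' y')" for x y x' y'
  proof (cases "x = x'")
    case True
    then show ?thesis
      unfolding J_def by (intro exI[of _ "Vertical_line x"]) simp
  next
    case False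
    then obtain m where m: "mul m x - mul m x' = y - y'"
      using join[of x x' "y - y'"] by blast
    have "y' = y - (mul m x - mul m x')"
      unfolding m by simp
    then show ?thesis
      unfolding J_def by (intro exI[of _ "Sloped_line m (y - mul m x)"]) simp
  qed
  have J_slope: "J (Affine_point x y) (Slope_point m)" for x y m
    unfolding J_def by (intro exI[of _ "Sloped_line m (y - mul m x)"]) simp
  have J_vert: "J (Affine_point x y) Vertical_point" for x y
    unfolding J_def by (intro exI[of _ "Vertical_line x"]) simp
  have J_inf: "J (Slope_point m) (Slope_point m')" "J (Slope_point m) Vertical_point"
      "J Vertical_point Vertical_point" for m m'
    unfolding J_def by (rule exI[of _ Infinite_line], simp)+
  have join_ex: "J p q" for p q
    by (cases p; cases q)
      (simp_all only: J_aff J_slope J_vert J_inf J_slope[THEN J_sym] J_vert[THEN J_sym] J_inf[THEN J_sym])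
  define M where "M k l \<longleftrightarrow> (\<exists>p. ?I p k \<and> ?I p l)" for k l
  have M_sym: "M k l \<Longrightarrow> M l k" for k l
    unfolding M_def by blast
  have M_sloped: "M (Sloped_line m k) (Sloped_line m' k')" for m k m' k'
  proof (cases "m = m'")
    case True
    then show ?thesis
      unfolding M_def by (intro exI[of _ "Slope_point m"]) simp
  next
    case False
    then obtain x where x: "mul m x - mul m' x = k' - k"
      using meet[of m m' "k' - k"] by blast
    have "k' = k + (mul m x - mul m' x)"
      unfolding x by simp
    then show ?thesis
      unfolding M_def by (intro exI[of _ "Affine_point x (mul m x + k)"]) simp
  qed
  have M_vert: "M (Sloped_line m k) (Vertical_line c)" for m k c
    unfolding M_def by (intro exI[of _ "Affine_point c (mul m c + k)"]) simp
  have M_inf: "M (Sloped_line m k) Infinite_line" for m k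
    unfolding M_def by (intro exI[of _ "Slope_point m"]) simp
  have M_vert': "M (Vertical_line c) (Vertical_line c')" "M (Vertical_line c) Infinite_line"
      "M Infinite_line Infinite_line" for c c'
    unfolding M_def by (rule exI[of _ Vertical_point], simp)+
  have meet_ex: "M k l" for k l
    by (cases k; cases l)
      (simp_all only: M_sloped M_vert M_inf M_vert' M_vert[THEN M_sym] M_inf[THEN M_sym] M_vert'[THEN M_sym])
  \<comment> \<open>This self-dual statement supplies uniqueness of joins and of meets at
    once.\<close>
  have unique: "p = q \<or> k = l" if "?I p k" "?I p l" "?I q k" "?I q l" for p q k l
  proof -
    have sloped: "x = x' \<or> m = m' \<and> k = k'"
      if "mul m x + k = mul m' x + k'" "mul m x' + k = mul m' x' + k'" for x x' m m' k k'
    proof (cases "x = x'")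
      case False
      have "mul m x - mul m x' = mul m' x - mul m' x'"
        using that by (metis add_diff_cancel_right)
      then have "m = m'"
        using join[OF False, of "mul m x - mul m x'"] by metis
      then show ?thesis using that by simp
    qed simp
    show ?thesis
      using that by (cases p; cases q; cases k; cases l) (simp_all, metis sloped)
  qed
  have "\<exists>!l. ?I p l \<and> ?I q l" if "p \<noteq> q" for p q
    using join_ex[of p q] unique that unfolding J_def by blast
  moreover have "\<exists>!p. ?I p k \<and> ?I p l" if "k \<noteq> l" for k l
    using meet_ex[of k l] unique that unfolding M_def by blast
  moreover
  \<comment> \<open>The quadrangle consists of two points at infinity and two points on the
    diagonal. A line of slope 0 has equation y = k and meets the diagonal only in (k, k).\<close>
  let ?Q = "{Vertical_point, Slope_point 0, Affine_point 0 0, Affine_point a a}"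
  have "card ?Q = 4"
    using nontrivial by simp
  moreover have "card {p \<in> ?Q. ?I p l} \<le> 2" for l
  proof -
    have *: "card A \<le> 2" if "A \<subseteq> {p, q}" for A and p q :: "'s coord_point"
      using card_mono[OF _ that] by (simp add: card_insert_if split: if_splits)
    show ?thesis
    proof (cases l)
      case (Sloped_line m k)
      show ?thesis
      proof (cases "m = 0")
        case True
        then have "{p \<in> ?Q. ?I p l} \<subseteq> {Slope_point 0, Affine_point k k}"
          using Sloped_line zero nontrivial by auto
        then show ?thesis by (rule *)
      next
        case False
        then have "{p \<in> ?Q. ?I p l} \<subseteq> {Affine_point 0 0, Affine_point a a}"
          using Sloped_line by auto
        then show ?thesis by (rule *)
      qed
    next
      case (Vertical_line c)
      then have "{p \<in> ?Q. ?I p l} \<subseteq> {Vertical_point, Affine_point c c}"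
        by auto
      then show ?thesis by (rule *)
    next
      case Infinite_line
      then have "{p \<in> ?Q. ?I p l} \<subseteq> {Vertical_point, Slope_point 0}"
        by auto
      then show ?thesis by (rule *)
    qed
  qed
  ultimately show ?thesis
    unfolding projective_plane_def by (simp, intro exI[of _ ?Q], simp)
qed

text \<open>Distributivity in the second argument makes (x, y) -> (x + a, y + b) a collineation that
  preserves slopes, and a, b can be chosen to take any affine point to any other.\<close>

lemma presemifield_translation_line:
  assumes "presemifield S add z mul"
  shows "translation_line (coord_plane S add mul) Infinite_line"
proof -
  let ?G = "\<lparr>carrier = S, monoid.mult = add, one = z\<rparr>"
  let ?C = "coord_plane S add mul"
  interpret G: comm_group ?G
    using assms by (simp add: presemifield_def)
  have mul: "mul x y \<in> S" if "x \<in> S" "y \<in> S" for x y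
    using assms that by (simp add: presemifield_def)
  have distrib: "mul x (add y w) = add (mul x y) (mul x w)" if "x \<in> S" "y \<in> S" "w \<in> S" for x y w
    using assms that by (simp add: presemifield_def)
  have add: "add x y \<in> S" if "x \<in> S" "y \<in> S" for x y
    using G.m_closed that by simp
  have assoc: "add (add x y) w = add x (add y w)" if "x \<in> S" "y \<in> S" "w \<in> S" for x y w
    using G.m_assoc that by simp
  have commute: "add x y = add y x" if "x \<in> S" "y \<in> S" for x y
    using G.m_comm that by simp
  have lcommute: "add x (add y w) = add y (add x w)" if "x \<in> S" "y \<in> S" "w \<in> S" for x y w
    using G.m_lcomm that by simp
  have z: "z \<in> S" and zl: "\<And>x. x \<in> S \<Longrightarrow> add z x = x" and zr: "\<And>x. x \<in> S \<Longrightarrow> add x z = x"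
    using G.one_closed G.l_one G.r_one by simp_all
  define neg where "neg x = inv\<^bsub>?G\<^esub> x" for x
  have neg: "neg x \<in> S" "add x (neg x) = z" "add (neg x) x = z" if "x \<in> S" for x
    using G.inv_closed[of x] G.r_inv[of x] G.l_inv[of x] that by (simp_all add: neg_def)
  have cancel: "add x w = add y w \<longleftrightarrow> x = y" if "x \<in> S" "y \<in> S" "w \<in> S" for x y w
    using G.right_cancel that by simp
  have bij: "bij_betw (\<lambda>x. add x w) S S" if "w \<in> S" for w
  proof (rule bij_betw_byWitness[where f' = "\<lambda>x. add x (neg w)"])
    show "\<forall>x\<in>S. add (add x w) (neg w) = x" "\<forall>x\<in>S. add (add x (neg w)) w = x"
      using that by (simp_all add: assoc neg zr)
  qed (use add neg that in auto)
  define A where "A a b p = (case p of Affine_point x y \<Rightarrow> Affine_point (add x a) (add y b)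
      | Slope_point m \<Rightarrow> Slope_point m | Vertical_point \<Rightarrow> Vertical_point)" for a b p
  \<comment> \<open>The new intercept k + b - m a compensates for m (x + a) = m x + m a.\<close>
  define B where "B a b l = (case l of
      Sloped_line m k \<Rightarrow> Sloped_line m (add k (add b (neg (mul m a))))
      | Vertical_line c \<Rightarrow> Vertical_line (add c a) | Infinite_line \<Rightarrow> Infinite_line)" for a b l
  have iso: "isomorphism (A a b) (B a b) ?C ?C" if ab: "a \<in> S" "b \<in> S" for a b
    unfolding A_def B_def
  proof (rule isomorphism_coord_plane)
    fix x y m k assume S: "x \<in> S" "y \<in> S" "m \<in> S" "k \<in> S"
    define ma n where "ma = mul m a" and "n = neg ma"
    have ma: "ma \<in> S" "n \<in> S" "add ma n = z"
      unfolding n_def ma_def using mul[OF S(3) ab(1)] neg by blast+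
    have "add (mul m (add x a)) (add k (add b n)) = add (add (mul m x) ma) (add k (add b n))"
      by (simp only: distrib S ab ma_def)
    also have "\<dots> = add (add (mul m x) k) (add b (add ma n))"
      by (simp only: assoc commute lcommute add mul S ab ma(1,2))
    also have "\<dots> = add (add (mul m x) k) b"
      by (simp only: ma(3) zr ab)
    finally show "y = add (mul m x) k \<longleftrightarrow>
        add y b = add (mul m (add x a)) (add k (add b (neg (mul m a))))"
      using cancel[of y "add (mul m x) k" b] S ab add mul by (simp add: ma_def n_def)
  qed (use ab in \<open>simp_all add: bij add mul neg bij_betw_id[unfolded id_def]\<close>)
  have diff: "add x (add (neg x) y) = y" if "x \<in> S" "y \<in> S" for x y
    using that by (simp add: assoc[symmetric] neg zl)
  have inf: "Infinite_line \<in> lines ?C" by simp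
  show ?thesis
    unfolding translation_line_def
  proof (intro conjI[OF inf] ballI impI)
    fix c p q l
    assume S: "c \<in> points ?C" "p \<in> points ?C" "q \<in> points ?C" "l \<in> lines ?C"
      and *: "incident ?C c Infinite_line \<and> \<not> incident ?C p Infinite_line \<and>
        \<not> incident ?C q Infinite_line \<and> incident ?C c l \<and> incident ?C p l \<and> incident ?C q l"
    obtain x y where p: "p = Affine_point x y"
      using * by (cases p) simp_all
    obtain x' y' where q: "q = Affine_point x' y'"
      using * by (cases q) simp_all
    have xy: "x \<in> S" "y \<in> S" "x' \<in> S" "y' \<in> S"
      using S p q by simp_all
    let ?a = "add (neg x) x'" and ?b = "add (neg y) y'"
    have ab: "?a \<in> S" "?b \<in> S"
      using xy by (simp_all add: add neg)
    have fixed: "B ?a ?b k = k" if k: "k \<in> lines ?C" "incident ?C c k" for k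
    proof (cases c)
      case (Affine_point u v)
      then show ?thesis using * by simp
    next
      case (Slope_point m)
      have m: "m \<in> S" using S Slope_point by simp
      obtain k0 where l: "l = Sloped_line m k0" "k0 \<in> S"
        using * S Slope_point p by (cases l) simp_all
      have y: "y = add (mul m x) k0" "y' = add (mul m x') k0"
        using * p q l by simp_all
      have "add (mul m x) (mul m ?a) = mul m x'"
        using distrib[OF m xy(1) ab(1)] diff[OF xy(1,3)] by simp
      then have "add y (mul m ?a) = y'"
        unfolding y using l(2) m xy ab mul
        by (metis assoc commute)
      moreover have "add y ?b = y'"
        using diff xy by simp
      \<comment> \<open>Two points on a line of slope m differ by (a, m a); then the correction of
        the intercept is zero, and all lines of slope m are fixed.\<close>
      ultimately have "?b = mul m ?a"
        using xy ab m mul commute cancel by metis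
      then have "add ?b (neg (mul m ?a)) = z"
        using neg mul m ab by simp
      then show ?thesis
        using k Slope_point by (cases k) (simp_all add: B_def zr)
    next
      case Vertical_point
      then obtain v where l: "l = Vertical_line v"
        using * p by (cases l) simp_all
      then have "x = x'" using * p q by simp
      then have "?a = z" using neg xy by simp
      then show ?thesis
        using k Vertical_point by (cases k) (simp_all add: B_def zr)
    qed
    show "\<exists>\<alpha> \<beta>. isomorphism \<alpha> \<beta> ?C ?C \<and> \<alpha> p = q \<and>
        (\<forall>r\<in>points ?C. incident ?C r Infinite_line \<longrightarrow> \<alpha> r = r) \<and>
        (\<forall>k\<in>lines ?C. incident ?C c k \<longrightarrow> \<beta> k = k)"
    proof (intro exI conjI ballI impI)
      show "isomorphism (A ?a ?b) (B ?a ?b) ?C ?C"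
        by (rule iso[OF ab])
      show "A ?a ?b p = q"
        using diff xy by (simp add: p q A_def)
      show "A ?a ?b r = r" if "incident ?C r Infinite_line" for r
        using that by (cases r) (simp_all add: A_def)
      show "B ?a ?b k = k" if "k \<in> lines ?C" "incident ?C c k" for k
        using that by (rule fixed)
    qed
  qed
qed

text \<open>The translation with centre (0) taking (0, 0) to (a, 0) fixes all lines y = k and all
  slopes, and maps vertical lines to vertical lines; hence it is (x, y) -> (f x, y). It takes y = u
  x to the line of slope u through (a, 0), on which (f x, u x) must lie. Without distributivity f x
  cannot yet be identified with x + a.\<close>

lemma translation_line_Infinite_line_imp:
  fixes mul :: "'s::ab_group_add \<Rightarrow> 's \<Rightarrow> 's"
  assumes tl: "translation_line (coord_plane UNIV (+) mul) Infinite_line"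
    and zero_left: "\<And>x. mul 0 x = 0" and zero_right: "\<And>x. mul x 0 = 0"
  shows "\<exists>f. \<forall>x u. mul u (f x) = mul u x + mul u a"
proof -
  let ?C = "coord_plane UNIV (+) mul"
  have C: "Slope_point 0 \<in> points ?C" "Affine_point 0 0 \<in> points ?C" "Affine_point a 0 \<in> points ?C"
      "Sloped_line 0 0 \<in> lines ?C" "incident ?C (Slope_point 0) Infinite_line"
      "\<not> incident ?C (Affine_point 0 0) Infinite_line"
      "\<not> incident ?C (Affine_point a 0) Infinite_line"
      "incident ?C (Slope_point 0) (Sloped_line 0 0)"
      "incident ?C (Affine_point 0 0) (Sloped_line 0 0)"
      "incident ?C (Affine_point a 0) (Sloped_line 0 0)"
    by (simp_all add: zero_left)
  obtain \<alpha> \<beta> where iso: "isomorphism \<alpha> \<beta> ?C ?C"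
    and \<alpha>: "\<alpha> (Affine_point 0 0) = Affine_point a 0"
    and axis: "\<And>r. r \<in> points ?C \<Longrightarrow> incident ?C r Infinite_line \<Longrightarrow> \<alpha> r = r"
    and centre: "\<And>k. k \<in> lines ?C \<Longrightarrow> incident ?C (Slope_point 0) k \<Longrightarrow> \<beta> k = k"
    by (rule translation_lineE[OF tl C]) (rule that, assumption+)
  let ?I = "coord_incident (+) mul"
  have inc: "?I (\<alpha> p) (\<beta> l) \<longleftrightarrow> ?I p l" for p l
    using isomorphismD(3)[OF iso, of p l] by simp
  have \<alpha>_inf: "\<alpha> (Slope_point u) = Slope_point u" "\<alpha> Vertical_point = Vertical_point" for u
    by (rule axis; simp)+
  have \<beta>_fixed: "\<beta> (Sloped_line 0 y) = Sloped_line 0 y" "\<beta> Infinite_line = Infinite_line" for y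
    by (rule centre; simp)+
  have aff: "\<exists>x'. \<alpha> (Affine_point x y) = Affine_point x' y" for x y
  proof -
    have "\<not> ?I (\<alpha> (Affine_point x y)) Infinite_line"
      using inc[of "Affine_point x y" Infinite_line] by (simp add: \<beta>_fixed)
    moreover have "?I (\<alpha> (Affine_point x y)) (Sloped_line 0 y)"
      using inc[of "Affine_point x y" "Sloped_line 0 y"] by (simp add: \<beta>_fixed zero_left)
    ultimately show ?thesis
      by (cases "\<alpha> (Affine_point x y)") (simp_all add: zero_left)
  qed
  have vert: "\<exists>x'. \<beta> (Vertical_line x) = Vertical_line x'" for x
  proof -
    have "?I Vertical_point (\<beta> (Vertical_line x))"
      using inc[of Vertical_point "Vertical_line x"] by (simp add: \<alpha>_inf)
    moreover obtain x' where "\<alpha> (Affine_point x 0) = Affine_point x' 0"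
      using aff by blast
    then have "?I (Affine_point x' 0) (\<beta> (Vertical_line x))"
      using inc[of "Affine_point x 0" "Vertical_line x"] by simp
    ultimately show ?thesis
      by (cases "\<beta> (Vertical_line x)") simp_all
  qed
  then obtain f where f: "\<And>x. \<beta> (Vertical_line x) = Vertical_line (f x)"
    by metis
  have \<alpha>_aff: "\<alpha> (Affine_point x y) = Affine_point (f x) y" for x y
  proof -
    obtain x' where "\<alpha> (Affine_point x y) = Affine_point x' y"
      using aff by blast
    then show ?thesis
      using inc[of "Affine_point x y" "Vertical_line x"] by (simp add: f)
  qed
  have "f 0 = a"
    using \<alpha> by (simp add: \<alpha>_aff)
  have "mul u (f x) = mul u x + mul u a" for x u
  proof -
    have "?I (Slope_point u) (\<beta> (Sloped_line u 0))"
      using inc[of "Slope_point u" "Sloped_line u 0"] by (simp add: \<alpha>_inf)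
    moreover have on: "?I (Affine_point (f x) (mul u x)) (\<beta> (Sloped_line u 0))" for x
      using inc[of "Affine_point x (mul u x)" "Sloped_line u 0"] by (simp add: \<alpha>_aff)
    ultimately obtain c where c: "\<beta> (Sloped_line u 0) = Sloped_line u c"
      using on[of 0] by (cases "\<beta> (Sloped_line u 0)") simp_all
    have "0 = mul u a + c"
      using on[of 0] by (simp add: c zero_right \<open>f 0 = a\<close>)
    moreover have "mul u x = mul u (f x) + c"
      using on[of x] by (simp add: c)
    ultimately show ?thesis
      by (simp add: algebra_simps)
  qed
  then show ?thesis by blast
qed

subsection \<open>Pairs over the ring of integers modulo 4\<close>

lemma Z4_cases: "z = 0 \<or> z = 1 \<or> z = 2 \<or> z = (3 :: 4)"
proof -
  obtain n where n: "z = of_int n" "0 \<le> n" "n < 4"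
    using bit0.cases[of z] by auto
  then have "n = 0 \<or> n = 1 \<or> n = 2 \<or> n = 3" by auto
  with n(1) show ?thesis by auto
qed

lemma lift_bit_eq_iff: "lift_bit a + 2 * lift_bit b = lift_bit c + 2 * lift_bit d \<longleftrightarrow> a = c \<and> b = d"
  by (cases a; cases b; cases c; cases d) (simp_all add: lift_bit_def)

lemma lift_bit_surj: "\<exists>a b. z = lift_bit a + 2 * lift_bit b"
proof -
  have "z = lift_bit 0 + 2 * lift_bit 0 \<or> z = lift_bit 1 + 2 * lift_bit 0 \<or>
      z = lift_bit 0 + 2 * lift_bit 1 \<or> z = lift_bit 1 + 2 * lift_bit 1"
    using Z4_cases[of z] by (simp add: lift_bit_def)
  then show ?thesis by blast
qed

text \<open>The term a * c is the carry of the low digits; it is the origin of the product in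
  \<open>ast\<close>.\<close>

lemma lift_bit_add:
  "(lift_bit a + 2 * lift_bit b) + (lift_bit c + 2 * lift_bit d) =
    lift_bit (a + c) + 2 * lift_bit (b + d + a * c)"
  by (cases a; cases b; cases c; cases d) (simp_all add: lift_bit_def)

lemma Z4_pair_nth: "Z4_pair a b $ i = lift_bit (a $ i) + 2 * lift_bit (b $ i)"
  by (simp add: Z4_pair_def lift_vec_def)

lemma Z4_pair_eq_iff: "Z4_pair a b = Z4_pair c d \<longleftrightarrow> a = c \<and> b = d"
  by (auto simp: vec_eq_iff Z4_pair_nth lift_bit_eq_iff)

lemma Z4_pair_add: "Z4_pair a b + Z4_pair c d = Z4_pair (a + c) (b + d + a * c)"
  by (simp add: vec_eq_iff Z4_pair_nth lift_bit_add)

lemma Z4_pair_zero: "Z4_pair 0 0 = 0"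
  by (simp add: vec_eq_iff Z4_pair_nth lift_bit_def)

lemma Z4_pair_surj: "\<exists>a b. z = Z4_pair a b"
proof -
  have "\<forall>i. \<exists>a b. z $ i = lift_bit a + 2 * lift_bit b"
    using lift_bit_surj by blast
  then obtain a b where "\<forall>i. z $ i = lift_bit (a i) + 2 * lift_bit (b i)"
    by (atomize_elim) (simp add: choice_iff)
  then have "z = Z4_pair (\<chi> i. a i) (\<chi> i. b i)"
    by (simp add: vec_eq_iff Z4_pair_nth)
  then show ?thesis by blast
qed

lemma Z4_pair_diff: "Z4_pair a b - Z4_pair c d = Z4_pair (a + c) (b + d + (a + c) * c)"
  by (simp add: diff_eq_eq Z4_pair_add distrib_right add.assoc add.left_commute[of "c * c"]
      add.left_commute[of c])

lemma twice_Z4_eq: "twice_Z4 = range (Z4_pair 0)"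
proof -
  have double: "2 * Z4_pair a b = Z4_pair 0 a" for a b :: "bit ^ 'n"
    unfolding mult_2 Z4_pair_add by simp
  show ?thesis
    unfolding twice_Z4_def
  proof (intro equalityI subsetI; elim rangeE)
    fix y z assume y: "y = 2 * (z :: 4 ^ 'n)"
    obtain a b where "z = Z4_pair a b" using Z4_pair_surj by blast
    then show "y \<in> range (Z4_pair 0)" by (simp add: y double)
  next
    fix y and a :: "bit ^ 'n" assume "y = Z4_pair 0 a"
    then show "y \<in> range ((*) 2)" by (metis double rangeI)
  qed
qed

lemma Z4_pair_mem_twice_Z4: "Z4_pair a b \<in> twice_Z4 \<longleftrightarrow> a = 0"
  by (auto simp: twice_Z4_eq Z4_pair_eq_iff)

subsection \<open>The map representing a relative difference set\<close>

context
  fixes D :: "(4 ^ 'n::finite) set"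
  assumes rds: "relative_difference_set D twice_Z4 (2 ^ CARD('n)) (2 ^ CARD('n)) (2 ^ CARD('n)) 1"
begin

text \<open>Two elements of D in one coset would differ by a forbidden nonzero element, and D has as
  many elements as there are cosets.\<close>

lemma rds_transversal: "\<exists>!y. Z4_pair x y \<in> D"
proof -
  have unique: "y = y'" if "Z4_pair x y \<in> D" "Z4_pair x y' \<in> D" for x y y'
  proof -
    have "Z4_pair x y - Z4_pair x y' \<notin> twice_Z4 - {0}"
      using rds that unfolding relative_difference_set_def by blast
    then show ?thesis
      by (simp add: Z4_pair_diff Z4_pair_mem_twice_Z4 Z4_pair_zero[symmetric] Z4_pair_eq_iff
          vec2_eq_iff[of y y'] del: Z4_pair_zero)
  qed
  define E where "E = {(a, b). Z4_pair a b \<in> D}"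
  have "d \<in> (\<lambda>(a, b). Z4_pair a b) ` E" if "d \<in> D" for d
  proof -
    obtain a b where "d = Z4_pair a b" using Z4_pair_surj by blast
    then show ?thesis using that by (auto simp: E_def)
  qed
  then have "D = (\<lambda>(a, b). Z4_pair a b) ` E"
    by (auto simp: E_def)
  moreover have "inj_on (\<lambda>(a, b). Z4_pair a b) E"
    by (auto simp: inj_on_def Z4_pair_eq_iff)
  ultimately have "card E = card D"
    by (simp add: card_image)
  moreover have "inj_on fst E"
    using unique by (auto simp: inj_on_def E_def)
  ultimately have "card (fst ` E) = CARD(bit ^ 'n)"
    using rds by (simp add: card_image card_bit relative_difference_set_def)
  then have "fst ` E = UNIV"
    by (intro card_subset_eq) auto
  then have "x \<in> fst ` E" by simp
  then show ?thesis
    using unique by (auto simp: E_def)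
qed

lemma Z4_pair_mem_rds: "Z4_pair x y \<in> D \<longleftrightarrow> y = F2_rep D x"
  unfolding F2_rep_def using theI'[OF rds_transversal[of x]] rds_transversal[of x] by blast

text \<open>The elements of D over x + a and x differ by the pair with first entry a and second
  entry the left-hand side. As a is nonzero, each such pair is a difference of D exactly
  once.\<close>

lemma F2_rep_planar:
  assumes "a \<noteq> 0"
  shows "\<exists>!x. F2_rep D (x + a) + F2_rep D x + a * x = b"
proof -
  let ?f = "\<lambda>x. (Z4_pair (x + a) (F2_rep D (x + a)), Z4_pair x (F2_rep D x))"
  have "card {(p, q). p \<in> D \<and> q \<in> D \<and> p - q = Z4_pair a b} = 1"
    using rds assms by (simp add: relative_difference_set_def Z4_pair_mem_twice_Z4)
  then obtain pq where pq: "{(p, q). p \<in> D \<and> q \<in> D \<and> p - q = Z4_pair a b} = {pq}"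
    by (rule card_1_singletonE)
  have iff: "F2_rep D (x + a) + F2_rep D x + a * x = b \<longleftrightarrow>
      ?f x \<in> {(p, q). p \<in> D \<and> q \<in> D \<and> p - q = Z4_pair a b}" for x
    by (simp add: Z4_pair_mem_rds Z4_pair_diff Z4_pair_eq_iff ac_simps)
  obtain p q where pq': "pq = (p, q)" by (cases pq)
  obtain x y where q: "q = Z4_pair x y" using Z4_pair_surj by blast
  obtain x' y' where p: "p = Z4_pair x' y'" using Z4_pair_surj by blast
  have "pq \<in> {(p, q). p \<in> D \<and> q \<in> D \<and> p - q = Z4_pair a b}"
    using pq by blast
  then have "x' = x + a" "y' = F2_rep D x'" "y = F2_rep D x"
    by (auto simp: pq' p q Z4_pair_mem_rds Z4_pair_diff Z4_pair_eq_iff add.commute)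
  then have "?f x = pq"
    by (simp add: pq' p q)
  show ?thesis
  proof (rule ex1I[of _ x])
    show "F2_rep D (x + a) + F2_rep D x + a * x = b"
      unfolding iff pq \<open>?f x = pq\<close> by simp
    fix w assume "F2_rep D (w + a) + F2_rep D w + a * w = b"
    then have "?f w = pq"
      unfolding iff pq by blast
    then show "w = x"
      using \<open>?f x = pq\<close> by (metis Z4_pair_eq_iff snd_conv)
  qed
qed

end

lemma bij_add_right: "bij (\<lambda>x :: 'a::group_add. x + a)"
  by (rule bij_betw_byWitness[where f' = "\<lambda>x. x - a"]) auto

text \<open>A form of planarity for characteristic 2: the carry a * x replaces the bijectivity of x
  -> h (x + a) - h x, which is impossible there because x and x + a give the same value.\<close>

definition planar_map :: "(bit ^ 'n::finite \<Rightarrow> bit ^ 'n) \<Rightarrow> bool" where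
  "planar_map h \<longleftrightarrow> (\<forall>a b. a \<noteq> 0 \<longrightarrow> (\<exists>!x. h (x + a) + h x + a * x = b))"

lemma planar_mapD: "planar_map h \<Longrightarrow> a \<noteq> 0 \<Longrightarrow> \<exists>!x. h (x + a) + h x + a * x = b"
  unfolding planar_map_def by (elim allE) (erule mp)

subsection \<open>The multiplications \<open>*\<close> and \<open>\<star>\<close>\<close>

lemma ast_commute: "ast h x y = ast h y x"
  by (simp add: ast_def ac_simps)

text \<open>The product x * y is additive in y, so the defect of additivity of
  \<open>ast h x\<close> is exactly the third difference of \<open>h\<close>.\<close>

lemma third_diff_zero_iff_additive_ast: "third_diff_zero h \<longleftrightarrow> (\<forall>x. additive (ast h x))"
proof -
  have "ast h x (y + z) + (ast h x y + ast h x z) =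
      h (x + y + z) + h (x + y) + h (x + z) + h (y + z) + h x + h y + h z" for x y z
    by (simp add: ast_def distrib_left ac_simps)
  then show ?thesis
    unfolding third_diff_zero_def additive_def vec2_eq_iff[of "ast h _ _"] by simp
qed

text \<open>The correction on the left does not involve x. Hence (x, y) -> (x + a, y +
  \<open>ast h a x\<close>) maps lines of slope m to lines of slope m + a, even when
  \<open>ast\<close> is not distributive.\<close>

lemma ast_translate:
  "ast h (m + a) (x + a) + (h m + h a + h (m + a) + (m + a) * a) = ast h m x + ast h a x"
  by (simp add: ast_def distrib_left distrib_right ac_simps)

lemma comm_group_additive: "comm_group \<lparr>carrier = UNIV, monoid.mult = (+), one = 0 :: 'a::ab_group_add\<rparr>"
proof (rule comm_groupI)
  fix x :: 'a
  show "\<exists>y\<in>carrier \<lparr>carrier = UNIV, monoid.mult = (+), one = 0\<rparr>.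
      y \<otimes>\<^bsub>\<lparr>carrier = UNIV, monoid.mult = (+), one = 0\<rparr>\<^esub> x = \<one>\<^bsub>\<lparr>carrier = UNIV, monoid.mult = (+), one = 0\<rparr>\<^esub>"
    by (intro bexI[of _ "- x"]) simp_all
qed (simp_all add: ac_simps)

text \<open>\<open>comm_semifield_plane\<close> asks for a semifield inside the type of points, so
  the structure is transported along an injection.\<close>

lemma comm_semifield_transfer:
  fixes mul :: "'a::ab_group_add \<Rightarrow> 'a \<Rightarrow> 'a" and e :: "'a \<Rightarrow> 's"
  assumes sf: "comm_semifield UNIV (+) 0 mul" and e: "inj e"
  shows "comm_semifield (range e) (\<lambda>x y. e (inv_into UNIV e x + inv_into UNIV e y)) (e 0) (\<lambda>x y. e (mul (inv_into UNIV e x) (inv_into UNIV e y)))"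
proof -
  note [simp] = inv_f_f[OF e] inj_eq[OF e]
  have "comm_group \<lparr>carrier = range e, monoid.mult = (\<lambda>x y. e (inv_into UNIV e x + inv_into UNIV e y)), one = e 0\<rparr>"
    (is "comm_group ?G")
  proof (rule comm_groupI)
    fix x assume "x \<in> carrier ?G"
    then obtain a where "x = e a" by auto
    then show "\<exists>y\<in>carrier ?G. y \<otimes>\<^bsub>?G\<^esub> x = \<one>\<^bsub>?G\<^esub>"
      by (intro bexI[of _ "e (- a)"]) simp_all
  qed (auto simp: ac_simps)
  then show ?thesis
    using sf unfolding comm_semifield_def semifield_def presemifield_def by (simp add: image_iff) blast
qed

context
  fixes h :: "bit ^ 'n::finite \<Rightarrow> bit ^ 'n"
  assumes h0: "h 0 = 0"
    and planar: "planar_map h"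
begin

lemma ast_zero_left: "ast h 0 x = 0"
  by (simp add: ast_def h0)

lemma ast_zero_right: "ast h x 0 = 0"
  by (simp add: ast_def h0)

lemma ast_self: "ast h x x = x"
  by (simp add: ast_def h0)

lemma ex1_ast_eq:
  assumes "a \<noteq> 0"
  shows "\<exists>!x. ast h a x = b"
proof -
  have "ast h a x = b \<longleftrightarrow> h (x + a) + h x + a * x = b + h a" for x
  proof -
    have "h (x + a) + h x + a * x = ast h a x + h a"
      by (simp add: ast_def ac_simps)
    then show ?thesis by (simp only: add_right_cancel)
  qed
  then show ?thesis
    using planar_mapD[OF planar assms, of "b + h a"] by (simp only:)
qed

lemma ast_eq_0D: "ast h x y = 0 \<Longrightarrow> x = 0 \<or> y = 0"
  using ex1_ast_eq[of x 0] ast_zero_right[of x] by blast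

text \<open>The substitution w = m + x turns the equation into planarity in the direction x + y;
  \<open>?c\<close> collects the terms without m.\<close>

lemma ex1_ast_diff_eq:
  assumes "x \<noteq> y"
  shows "\<exists>!m. ast h m x - ast h m y = d"
proof -
  let ?c = "h x + h y + x * (x + y)"
  have iff: "ast h m x - ast h m y = d \<longleftrightarrow> h ((m + x) + (x + y)) + h (m + x) + (x + y) * (m + x) = d + ?c" for m
  proof -
    have "h ((m + x) + (x + y)) + h (m + x) + (x + y) * (m + x) = (ast h m x - ast h m y) + ?c"
      by (simp add: ast_def vec2_diff distrib_left distrib_right ac_simps)
    then show ?thesis by (simp only: add_right_cancel)
  qed
  have "x + y \<noteq> 0"
    using assms by (simp flip: vec2_eq_iff)
  then obtain w where w: "h (w + (x + y)) + h w + (x + y) * w = d + ?c"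
    and unique: "\<And>v. h (v + (x + y)) + h v + (x + y) * v = d + ?c \<Longrightarrow> v = w"
    using planar_mapD[OF planar, of "x + y" "d + ?c"] by blast
  show ?thesis
  proof (rule ex1I[of _ "w + x"])
    have "w + x + x = w"
      by (simp add: add.assoc)
    then show "ast h (w + x) x - ast h (w + x) y = d"
      unfolding iff by (simp only: w)
    fix m assume "ast h m x - ast h m y = d"
    then have "m + x = w"
      unfolding iff by (rule unique)
    then show "m = w + x"
      by (simp add: add.assoc flip: \<open>m + x = w\<close>)
  qed
qed

lemma projective_plane_ast: "projective_plane (coord_plane UNIV (+) (ast h))"
proof (rule projective_plane_coord_plane)
  show "\<exists>!m. ast h m x - ast h m y = d" if "x \<noteq> y" for x y d
    using that by (rule ex1_ast_diff_eq)
  then show "\<exists>!x. ast h m x - ast h k x = d" if "m \<noteq> k" for m k d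
    using that by (simp only: ast_commute[of h m] ast_commute[of h k])
  show "(1 :: bit ^ 'n) \<noteq> 0" by simp
qed (rule ast_zero_left)

lemma comm_presemifield_ast_iff:
  "comm_presemifield UNIV (+) 0 (ast h) \<longleftrightarrow> (\<forall>x. additive (ast h x))"
proof
  assume "comm_presemifield UNIV (+) 0 (ast h)"
  then show "\<forall>x. additive (ast h x)"
    by (simp add: comm_presemifield_def presemifield_def additive_def)
next
  assume *: "\<forall>x. additive (ast h x)"
  have left: "ast h x (y + z) = ast h x y + ast h x z" for x y z
    using * by (simp add: additive_def)
  have right: "ast h (x + y) z = ast h x z + ast h y z" for x y z
    by (simp only: ast_commute[of h _ z] left)
  show "comm_presemifield UNIV (+) 0 (ast h)"
    unfolding comm_presemifield_def presemifield_def
    using comm_group_additive left right ast_eq_0D ast_commute by blast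
qed

lemma translation_line_ast_additive:
  assumes "translation_line (coord_plane UNIV (+) (ast h)) Infinite_line"
  shows "additive (ast h u)"
proof
  fix x a
  obtain f where f: "\<And>x u. ast h u (f x) = ast h u x + ast h u a"
    using translation_line_Infinite_line_imp[OF assms ast_zero_left ast_zero_right, of a]
    by blast
  \<comment> \<open>Idempotence lets the defining property of f be applied once in each argument;
    the two mixed products agree by commutativity and cancel.\<close>
  have "f x = ast h (f x) (f x)"
    by (simp add: ast_self)
  also have "\<dots> = ast h x (f x) + ast h a (f x)"
    by (simp only: f ast_commute[of h "f x"])
  also have "\<dots> = ast h x x + (ast h x a + ast h x a) + ast h a a"
    by (simp only: f ast_commute[of h a x] add.assoc)
  also have "\<dots> = x + a"
    by (simp add: ast_self)
  finally show "ast h u (x + a) = ast h u x + ast h u a"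
    using f by metis
qed

lemma translation_line_ast_Infinite_line:
  assumes l: "translation_line (coord_plane UNIV (+) (ast h)) l"
  shows "translation_line (coord_plane UNIV (+) (ast h)) Infinite_line"
proof -
  let ?C = "coord_plane UNIV (+) (ast h)"
  have thick: "\<exists>r\<in>points ?C. incident ?C r k \<and> r \<noteq> v" for k v
  proof (cases k)
    case (Sloped_line m c)
    then have "incident ?C (Slope_point m) k" "incident ?C (Affine_point 0 (ast h m 0 + c)) k"
      by simp_all
    then show ?thesis
      by (metis coord_plane_UNIV(1) UNIV_I coord_point.distinct(1))
  next
    case (Vertical_line c)
    then have "incident ?C Vertical_point k" "incident ?C (Affine_point c 0) k"
      by simp_all
    then show ?thesis
      by (metis coord_plane_UNIV(1) UNIV_I coord_point.distinct(3))
  next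
    case Infinite_line
    then have "incident ?C Vertical_point k" "incident ?C (Slope_point 0) k"
      by simp_all
    then show ?thesis
      by (metis coord_plane_UNIV(1) UNIV_I coord_point.distinct(5))
  qed
  have pencil: "translation_line ?C Infinite_line"
    if "translation_line ?C k" "l \<noteq> k" "incident ?C v l" "incident ?C v k" "incident ?C v Infinite_line"
    for k v
    by (rule translation_line_pencil[OF projective_plane_ast l that(1) _ that(2) _ that(3-5)])
      (simp, simp, rule thick)
  show ?thesis
  proof (cases l)
    case (Sloped_line m k)
    \<comment> \<open>Raising y by 1 gives a parallel translation line, and the two meet at infinity
      in \<open>Slope_point m\<close>.\<close>
    have "translation_line ?C (case l of Sloped_line m k \<Rightarrow> Sloped_line m (k + 1)
        | Vertical_line c \<Rightarrow> Vertical_line c | Infinite_line \<Rightarrow> Infinite_line)"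
      by (rule translation_line_isomorphism[OF isomorphism_coord_plane l, where g1 = "\<lambda>_ y. y + 1"])
        (simp_all add: bij_add_right bij_betw_id[unfolded id_def] flip: add.assoc)
    then have "translation_line ?C (Sloped_line m (k + 1))"
      by (simp add: Sloped_line)
    then show ?thesis
      by (rule pencil[of _ "Slope_point m"]) (simp_all add: Sloped_line)
  next
    case (Vertical_line c)
    \<comment> \<open>Changing y alone fixes vertical lines, and x -> x + 1 alone need not preserve
      lines, so the shear of \<open>ast_translate\<close> with the all-ones vector is used. The two
      vertical lines meet in \<open>Vertical_point\<close>.\<close>
    have "translation_line ?C (case l of
        Sloped_line m k \<Rightarrow> Sloped_line (m + 1) (k + (h m + h 1 + h (m + 1) + (m + 1) * 1))
        | Vertical_line c \<Rightarrow> Vertical_line (c + 1) | Infinite_line \<Rightarrow> Infinite_line)"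
    proof (rule translation_line_isomorphism[OF isomorphism_coord_plane l, where g1 = "\<lambda>x y. y + ast h 1 x"])
      fix x y m k
      have "ast h (m + 1) (x + 1) + (k + (h m + h 1 + h (m + 1) + (m + 1) * 1)) =
          (ast h m x + k) + ast h 1 x"
        using ast_translate[of h m 1 x] by (simp only: ac_simps)
      then show "y = ast h m x + k \<longleftrightarrow>
          y + ast h 1 x = ast h (m + 1) (x + 1) + (k + (h m + h 1 + h (m + 1) + (m + 1) * 1))"
        by (simp only: add_right_cancel)
    qed (simp_all only: bij_add_right)
    then have "translation_line ?C (Vertical_line (c + 1))"
      by (simp add: Vertical_line)
    then show ?thesis
      by (rule pencil[of _ "Vertical_point"]) (simp_all add: Vertical_line)
  next
    case Infinite_line
    then show ?thesis using l by simp
  qed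
qed

lemma comm_semifield_plane_isomorphicD:
  fixes P :: "('p, 'l) incidence_structure"
  assumes "comm_semifield_plane P" "isomorphic (coord_plane UNIV (+) (ast h)) P"
  shows "additive (ast h u)"
proof -
  let ?C = "coord_plane UNIV (+) (ast h)"
  have "\<exists>(S :: 'p set) add z mul. comm_semifield S add z mul \<and> isomorphic P (coord_plane S add mul)"
    using assms(1) unfolding comm_semifield_plane_def by (rule conjunct2)
  then show ?thesis
  proof (elim exE conjE)
    fix S :: "'p set" and add z mul
    assume S: "comm_semifield S add z mul" "isomorphic P (coord_plane S add mul)"
    then have tl: "translation_line (coord_plane S add mul) Infinite_line"
      by (intro presemifield_translation_line[where z = z]) (simp add: comm_semifield_def semifield_def)
    have "isomorphic (coord_plane S add mul) ?C"
      using isomorphic_trans[OF assms(2) S(2)] by (rule isomorphic_sym)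
    then obtain \<alpha> \<beta> where iso: "isomorphism \<alpha> \<beta> (coord_plane S add mul) ?C"
      unfolding isomorphic_iff by (elim exE)
    have "translation_line ?C (\<beta> Infinite_line)"
      by (rule translation_line_isomorphism[OF iso tl])
    then show ?thesis
      by (rule translation_line_ast_additive[OF translation_line_ast_Infinite_line])
  qed
qed

end

context
  fixes h :: "(bit, 'n::{finite, linorder}) vec \<Rightarrow> (bit, 'n) vec"
  assumes h0: "h 0 = 0"
    and planar: "planar_map h"
begin

lemma bij_ast_last_unit: "bij (ast h last_unit)"
proof -
  have "last_unit \<noteq> (0 :: (bit, 'n) vec)"
    by (simp add: last_unit_def axis_eq_0_iff)
  then have "\<exists>!x. ast h last_unit x = b" for b
    by (rule ex1_ast_eq[OF h0 planar])
  then show ?thesis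
    by (simp add: bij_iff)
qed

lemma ast_last_unit_star: "ast h last_unit (star h x y) = ast h x y"
  unfolding star_def by (rule surj_f_inv_f[OF bij_is_surj[OF bij_ast_last_unit]])

lemma star_eq_iff: "star h x y = z \<longleftrightarrow> ast h x y = ast h last_unit z"
  by (metis ast_last_unit_star bij_is_inj[OF bij_ast_last_unit] inj_eq)

lemma star_commute: "star h x y = star h y x"
  by (simp only: star_def ast_commute[of h x])

lemma comm_semifield_star:
  assumes "\<And>x. additive (ast h x)"
  shows "comm_semifield UNIV (+) 0 (star h)"
proof -
  have left: "star h x (y + z) = star h x y + star h x z" for x y z
    unfolding star_eq_iff by (simp only: additive.add[OF assms] ast_last_unit_star)
  have right: "star h (x + y) z = star h x z + star h y z" for x y z
    by (simp only: star_commute[of _ z] left)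
  have unit: "star h last_unit x = x" for x
    unfolding star_eq_iff ..
  have no_zero_divisors: "x = 0 \<or> y = 0" if "star h x y = 0" for x y
    using that unfolding star_eq_iff ast_zero_right[OF h0 planar] by (rule ast_eq_0D[OF h0 planar])
  have "presemifield UNIV (+) 0 (star h)"
    unfolding presemifield_def using comm_group_additive left right no_zero_divisors by blast
  moreover have "\<forall>x. star h last_unit x = x \<and> star h x last_unit = x"
    using unit star_commute by metis
  ultimately show ?thesis
    unfolding comm_semifield_def semifield_def using star_commute by blast
qed

lemma comm_semifield_star_iff:
  "comm_semifield UNIV (+) 0 (star h) \<longleftrightarrow> (\<forall>x. additive (ast h x))"
proof
  assume "comm_semifield UNIV (+) 0 (star h)"
  then have left: "star h x (y + z) = star h x y + star h x z"
    and right: "star h (x + y) z = star h x z + star h y z" for x y z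
    by (simp_all add: comm_semifield_def semifield_def presemifield_def)
  let ?T = "ast h last_unit"
  text \<open>Since \<open>x * x = x\<close>, the square \<open>x \<star> x\<close> is \<open>\<tau> x\<close>; hence distributivity makes \<open>\<tau>\<close> additive.\<close>
  have square: "?T (star h x x) = x" for x
    by (simp only: ast_last_unit_star ast_self[OF h0 planar])
  have T_add: "?T (x + y) = ?T x + ?T y" for x y
  proof -
    \<comment> \<open>Squaring for the commutative \<open>star h\<close> is additive in
      characteristic 2, and the square of \<open>?T z\<close> is z.\<close>
    have "star h (?T x + ?T y) (?T x + ?T y) =
        star h (?T x) (?T x) + (star h (?T x) (?T y) + star h (?T x) (?T y)) + star h (?T y) (?T y)"
      by (simp only: left right star_commute[of "?T y" "?T x"] add.assoc)
    also have "\<dots> = x + y"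
    proof -
      have "star h (?T z) (?T z) = z" for z
        unfolding star_eq_iff by (rule ast_self[OF h0 planar])
      then show ?thesis by simp
    qed
    finally show ?thesis
      using square[of "?T x + ?T y"] by (simp only:)
  qed
  have "ast h x (y + z) = ast h x y + ast h x z" for x y z
  proof -
    have "ast h x (y + z) = ?T (star h x (y + z))"
      by (simp only: ast_last_unit_star)
    also have "\<dots> = ?T (star h x y) + ?T (star h x z)"
      by (simp only: left T_add)
    finally show ?thesis
      by (simp only: ast_last_unit_star)
  qed
  then show "\<forall>x. additive (ast h x)"
    by (simp add: additive_def)
qed (intro comm_semifield_star, simp)

text \<open>\<open>star\<close> is an isotope of \<open>ast\<close>: applying \<open>?\<tau>\<close>
  to ordinates and intercepts, while leaving abscissas and slopes unchanged, turns one plane into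
  the other. The map e only relabels.\<close>

lemma comm_semifield_plane_coord_plane:
  fixes e :: "(bit, 'n) vec \<Rightarrow> 'p"
  assumes add: "\<And>x. additive (ast h x)" and e: "inj e"
  shows "\<exists>(S :: 'p set) add z mul. comm_semifield S add z mul \<and>
    isomorphic (coord_plane UNIV (+) (ast h)) (coord_plane S add mul)"
proof (intro exI conjI)
  let ?d = "inv_into UNIV e" and ?\<tau> = "inv_into UNIV (ast h last_unit)"
  show "comm_semifield (range e) (\<lambda>x y. e (?d x + ?d y)) (e 0) (\<lambda>x y. e (star h (?d x) (?d y)))"
    by (rule comm_semifield_transfer[OF comm_semifield_star[OF add] e])
  have \<tau>: "bij ?\<tau>"
    by (rule bij_imp_bij_inv[OF bij_ast_last_unit])
  have T\<tau>: "ast h last_unit (?\<tau> x) = x" for x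
    by (rule surj_f_inv_f[OF bij_is_surj[OF bij_ast_last_unit]])
  have "?\<tau> (x + y) = ?\<tau> x + ?\<tau> y" for x y
    by (rule inv_f_eq[OF bij_is_inj[OF bij_ast_last_unit]]) (simp only: additive.add[OF add] T\<tau>)
  then have \<tau>_add: "?\<tau> (ast h x y + z) = star h x y + ?\<tau> z" for x y z
    by (simp add: star_def)
  have e_bij: "bij_betw e UNIV (range e)"
    using e by (simp add: bij_betw_def)
  have e\<tau>_bij: "bij_betw (\<lambda>x. e (?\<tau> x)) UNIV (range e)"
    using bij_betw_trans[OF \<tau> e_bij] by (simp add: o_def)
  show "isomorphic (coord_plane UNIV (+) (ast h))
      (coord_plane (range e) (\<lambda>x y. e (?d x + ?d y)) (\<lambda>x y. e (star h (?d x) (?d y))))"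
    unfolding isomorphic_iff
  proof (intro exI, rule isomorphism_coord_plane[where f = e and g = "\<lambda>_ y. e (?\<tau> y)" and s = e and t = "\<lambda>_ k. e (?\<tau> k)"])
    fix x y m k
    show "y = ast h m x + k \<longleftrightarrow>
        e (?\<tau> y) = e (?d (e (star h (?d (e m)) (?d (e x)))) + ?d (e (?\<tau> k)))"
      by (simp only: inv_f_f[OF e] inj_eq[OF e] \<tau>_add[symmetric] inj_eq[OF bij_is_inj[OF \<tau>]])
  qed (rule e_bij e\<tau>_bij)+
qed

end

subsection \<open>Coordinates of the plane of a relative difference set\<close>

context
  fixes D :: "(4 ^ 'n::finite) set" and h a :: "bit ^ 'n \<Rightarrow> bit ^ 'n" and k :: "bit ^ 'n"
  assumes rds: "relative_difference_set D twice_Z4 (2 ^ CARD('n)) (2 ^ CARD('n)) (2 ^ CARD('n)) 1"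
    and a: "additive a" and rep: "\<And>x. F2_rep D x = h x + a x + k"
begin

text \<open>In the sum over x + u and x the constant cancels and \<open>a\<close> leaves only a u,
  which shifts the right-hand side.\<close>

lemma planar_normalized: "planar_map h"
  unfolding planar_map_def
proof (intro allI impI)
  fix u b :: "bit ^ 'n" assume "u \<noteq> 0"
  have "h (x + u) + h x + u * x = b \<longleftrightarrow> F2_rep D (x + u) + F2_rep D x + u * x = b + a u" for x
  proof -
    have "F2_rep D (x + u) + F2_rep D x + u * x = (h (x + u) + h x + u * x) + a u"
      by (simp add: rep additive.add[OF a] ac_simps)
    then show ?thesis by (simp only: add_right_cancel)
  qed
  then show "\<exists>!x. h (x + u) + h x + u * x = b"
    using F2_rep_planar[OF rds \<open>u \<noteq> 0\<close>, of "b + a u"] by (simp only:)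
qed

lemma Z4_pair_mem_translate_rds:
  "Z4_pair x y \<in> translate D (Z4_pair u v) \<longleftrightarrow> y = F2_rep D (x + u) + v + (x + u) * u"
proof
  assume "Z4_pair x y \<in> translate D (Z4_pair u v)"
  then obtain d where d: "d \<in> D" "Z4_pair x y = d + Z4_pair u v"
    by (auto simp: translate_def)
  obtain x' y' where "d = Z4_pair x' y'" using Z4_pair_surj by blast
  then have "x = x' + u" "y = F2_rep D x' + v + x' * u"
    using d by (simp_all add: Z4_pair_mem_rds[OF rds] Z4_pair_add Z4_pair_eq_iff)
  then show "y = F2_rep D (x + u) + v + (x + u) * u"
    by (simp add: add.assoc)
next
  assume "y = F2_rep D (x + u) + v + (x + u) * u"
  then have "Z4_pair x y = Z4_pair (x + u) (F2_rep D (x + u)) + Z4_pair u v"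
    by (simp add: Z4_pair_add add.assoc)
  then show "Z4_pair x y \<in> translate D (Z4_pair u v)"
    unfolding translate_def using Z4_pair_mem_rds[OF rds] by blast
qed

lemma Z4_pair_mem_translate_twice_Z4: "Z4_pair x y \<in> translate twice_Z4 (Z4_pair u v) \<longleftrightarrow> x = u"
proof
  assume "x = u"
  then have "Z4_pair x y = Z4_pair 0 (y + v) + Z4_pair u v"
    by (simp add: Z4_pair_add add.assoc)
  then show "Z4_pair x y \<in> translate twice_Z4 (Z4_pair u v)"
    unfolding translate_def twice_Z4_eq by blast
qed (auto simp: translate_def twice_Z4_eq Z4_pair_add Z4_pair_eq_iff)

text \<open>If translates with u different from u' coincided, the planarity equation in the
  direction u + u' would hold for every x with one and the same right-hand side.\<close>

lemma translate_rds_eq_iff: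
  "translate D (Z4_pair u v) = translate D (Z4_pair u' v') \<longleftrightarrow> u = u' \<and> v = v'"
proof
  assume "translate D (Z4_pair u v) = translate D (Z4_pair u' v')"
  then have eq: "F2_rep D (x + u) + v + (x + u) * u = F2_rep D (x + u') + v' + (x + u') * u'" for x
    using Z4_pair_mem_translate_rds by metis
  have "u = u'"
  proof (rule ccontr)
    assume "u \<noteq> u'"
    define w where "w = u + u'"
    then have "w \<noteq> 0" using \<open>u \<noteq> u'\<close> vec2_eq_iff by metis
    let ?b = "v + v' + u + u' + w * u"
    have "F2_rep D (x + w) + F2_rep D x + w * x = ?b" for x
    proof -
      have "F2_rep D x + (v + (x * u)) = F2_rep D (x + w) + (v' + (x + w) * u')"
        using eq[of "x + u"] by (simp add: w_def add.assoc)
      then have "F2_rep D (x + w) = F2_rep D x + (v + (x * u)) + (v' + (x + w) * u')"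
        by (simp add: add.assoc)
      then show ?thesis
        by (simp add: w_def distrib_left distrib_right ac_simps)
    qed
    then show False
      using F2_rep_planar[OF rds \<open>w \<noteq> 0\<close>, of ?b] \<open>w \<noteq> 0\<close> by metis
  qed
  then show "u = u' \<and> v = v'"
    using eq[of 0] by simp
qed simp

lemma parallel_class_rds:
  "parallel_class D twice_Z4 (Z4_pair u v) = range (\<lambda>w. translate D (Z4_pair u w))"
proof -
  have "parallel_class D twice_Z4 (Z4_pair u v) = range (\<lambda>w. translate D (Z4_pair u v + Z4_pair 0 w))"
    unfolding parallel_class_def twice_Z4_eq by blast
  also have "\<dots> = range (\<lambda>w. translate D (Z4_pair u (v + w)))"
    by (simp add: Z4_pair_add)
  also have "\<dots> = range (\<lambda>w. translate D (Z4_pair u w))"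
  proof (intro equalityI subsetI; elim rangeE; hypsubst)
    fix w
    have "translate D (Z4_pair u w) = translate D (Z4_pair u (v + (v + w)))" by simp
    then show "translate D (Z4_pair u w) \<in> range (\<lambda>w. translate D (Z4_pair u (v + w)))" by blast
  qed blast
  finally show ?thesis .
qed

text \<open>Adding \<open>?F x\<close> to the ordinate straightens the translates of D: the second
  difference of \<open>?F\<close> appears, and its affine part drops out up to constants.\<close>

lemma isomorphic_rds_plane:
  assumes h0: "h 0 = 0"
  shows "isomorphic (coord_plane UNIV (+) (ast h)) (rds_plane D twice_Z4)"
proof -
  let ?F = "F2_rep D"
  \<comment> \<open>Here \<open>?F u\<close> completes \<open>ast\<close>, u compensates for u * u =
    u in the equation of a translate, and \<open>?F 0\<close> removes the leftover constant.\<close>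
  let ?c = "\<lambda>u. u + ?F u + ?F 0"
  define \<alpha> where "\<alpha> p = (case p of Affine_point x y \<Rightarrow> Group_point (Z4_pair x (y + ?F x))
    | Slope_point u \<Rightarrow> Class_point (parallel_class D twice_Z4 (Z4_pair u 0))
    | Vertical_point \<Rightarrow> Infinity_point)" for p
  define \<beta> where "\<beta> l = (case l of Sloped_line u c \<Rightarrow> Translate_line (translate D (Z4_pair u (c + ?c u)))
    | Vertical_line c \<Rightarrow> Coset_line (translate twice_Z4 (Z4_pair c 0))
    | Infinite_line \<Rightarrow> Infinity_line)" for l
  have class_mem: "translate D (Z4_pair u v) \<in> parallel_class D twice_Z4 (Z4_pair u' v') \<longleftrightarrow> u = u'"
    for u v u' v'
    unfolding parallel_class_rds by (auto simp: translate_rds_eq_iff)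
  have class_eq: "parallel_class D twice_Z4 (Z4_pair u v) = parallel_class D twice_Z4 (Z4_pair u' v') \<longleftrightarrow> u = u'"
    for u v u' v'
  proof
    assume "parallel_class D twice_Z4 (Z4_pair u v) = parallel_class D twice_Z4 (Z4_pair u' v')"
    then show "u = u'" using class_mem[of u 0] by blast
  qed (simp add: parallel_class_rds)
  have coset_eq: "translate twice_Z4 (Z4_pair u v) = translate twice_Z4 (Z4_pair u' v') \<longleftrightarrow> u = u'"
    for u v u' v'
  proof
    assume "translate twice_Z4 (Z4_pair u v) = translate twice_Z4 (Z4_pair u' v')"
    then show "u = u'" using Z4_pair_mem_translate_twice_Z4[of u 0] by blast
  next
    assume "u = u'"
    then have "z \<in> translate twice_Z4 (Z4_pair u v) \<longleftrightarrow> z \<in> translate twice_Z4 (Z4_pair u' v')" for z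
      using Z4_pair_surj[of z] by (auto simp: Z4_pair_mem_translate_twice_Z4)
    then show "translate twice_Z4 (Z4_pair u v) = translate twice_Z4 (Z4_pair u' v')" by blast
  qed
  have "bij_betw \<alpha> UNIV (points (rds_plane D twice_Z4))"
  proof (rule bij_betw_imageI)
    show "inj \<alpha>"
    proof (rule injI)
      fix p q assume "\<alpha> p = \<alpha> q"
      then show "p = q"
        by (cases p; cases q) (auto simp: \<alpha>_def Z4_pair_eq_iff class_eq)
    qed
    have "p \<in> range \<alpha>" if p: "p \<in> points (rds_plane D twice_Z4)" for p
    proof -
      consider g where "p = Group_point g" | g where "p = Class_point (parallel_class D twice_Z4 g)"
        | "p = Infinity_point"
        using p by (auto simp: rds_plane_def)
      then show ?thesis
      proof cases
        case (1 g)
        obtain x y where "g = Z4_pair x y" using Z4_pair_surj by blast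
        then have "p = \<alpha> (Affine_point x (y + ?F x))"
          by (simp add: 1 \<alpha>_def add.assoc)
        then show ?thesis by blast
      next
        case (2 g)
        obtain u v where "g = Z4_pair u v" using Z4_pair_surj by blast
        then have "p = \<alpha> (Slope_point u)"
          by (simp add: 2 \<alpha>_def class_eq)
        then show ?thesis by blast
      next
        case 3
        then have "p = \<alpha> Vertical_point" by (simp add: \<alpha>_def)
        then show ?thesis by blast
      qed
    qed
    moreover have "\<alpha> p \<in> points (rds_plane D twice_Z4)" for p
      by (cases p) (simp_all add: \<alpha>_def rds_plane_def)
    ultimately show "range \<alpha> = points (rds_plane D twice_Z4)" by blast
  qed
  moreover have "bij_betw \<beta> UNIV (lines (rds_plane D twice_Z4))"
  proof (rule bij_betw_imageI)
    show "inj \<beta>"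
    proof (rule injI)
      fix k l assume "\<beta> k = \<beta> l"
      then show "k = l"
        by (cases k; cases l) (auto simp: \<beta>_def translate_rds_eq_iff coset_eq)
    qed
    have "l \<in> range \<beta>" if l: "l \<in> lines (rds_plane D twice_Z4)" for l
    proof -
      consider g where "l = Translate_line (translate D g)"
        | g where "l = Coset_line (translate twice_Z4 g)" | "l = Infinity_line"
        using l by (auto simp: rds_plane_def)
      then show ?thesis
      proof cases
        case (1 g)
        obtain u v where "g = Z4_pair u v" using Z4_pair_surj by blast
        then have "l = \<beta> (Sloped_line u (v + ?c u))"
          by (simp add: 1 \<beta>_def add.assoc)
        then show ?thesis by blast
      next
        case (2 g)
        obtain u v where "g = Z4_pair u v" using Z4_pair_surj by blast
        then have "l = \<beta> (Vertical_line u)"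
          by (simp add: 2 \<beta>_def coset_eq)
        then show ?thesis by blast
      next
        case 3
        then have "l = \<beta> Infinite_line" by (simp add: \<beta>_def)
        then show ?thesis by blast
      qed
    qed
    moreover have "\<beta> l \<in> lines (rds_plane D twice_Z4)" for l
      by (cases l) (simp_all add: \<beta>_def rds_plane_def)
    ultimately show "range \<beta> = lines (rds_plane D twice_Z4)" by blast
  qed
  moreover have "coord_incident (+) (ast h) p l \<longleftrightarrow> rds_incident (\<alpha> p) (\<beta> l)" for p l
  proof -
    have "y = ast h u x + c \<longleftrightarrow> y + ?F x = ?F (x + u) + (c + ?c u) + (x + u) * u" for x y u c
    proof -
      have "?F (x + u) + (c + ?c u) + (x + u) * u = (ast h u x + c) + ?F x"
        by (simp add: rep ast_def additive.add[OF a] additive.zero[OF a] h0 distrib_left ac_simps)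
      then show ?thesis by (simp only: add_right_cancel)
    qed
    then show ?thesis
      by (cases p; cases l)
        (simp_all add: \<alpha>_def \<beta>_def Z4_pair_mem_translate_rds Z4_pair_mem_translate_twice_Z4
          class_mem eq_commute)
  qed
  ultimately show ?thesis
    unfolding isomorphic_iff isomorphism_def by (intro exI[of _ \<alpha>] exI[of _ \<beta>]) (simp add: rds_plane_def)
qed

end

theorem theorem3p1:
  fixes D :: "(4 ^ 'n::{finite, linorder}) set"
    and h :: "bit ^ 'n::{finite, linorder} \<Rightarrow> bit ^ 'n::{finite, linorder}"
    and \<xi> :: "'n::{finite, linorder} \<Rightarrow> 'k::{field, finite}"
  assumes rds: "relative_difference_set D twice_Z4
      (2 ^ CARD('n)) (2 ^ CARD('n)) (2 ^ CARD('n)) 1"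
    and h: "h = normalized_F2_rep D"
    and card_field: "CARD('k) = 2 ^ CARD('n)"
    and basis: "F2_basis \<xi>"
  shows "all_equivalent
    [comm_semifield UNIV (+) 0 (star h),
     comm_presemifield UNIV (+) 0 (ast h),
     \<forall>x y z. h (x + y + z) + h (x + y) + h (x + z) + h (y + z) + h x + h y + h z = 0,
     \<forall>i. algebraic_degree (\<lambda>x. h x $ i) \<le> 2,
     Dembowski_Ostrom (normalized_field_rep \<xi> D),
     comm_semifield_plane (rds_plane D twice_Z4)]"
proof -
  \<comment> \<open>The coordinatewise additive corrections are assembled into one additive vector
    map; the constant k is \<open>F2_rep D 0\<close>.\<close>
  have "\<forall>i. \<exists>b. additive b \<and> (\<forall>x. F2_rep D x $ i = h x $ i + b x + F2_rep D 0 $ i)"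
    using remove_affine_terms_diff[of "\<lambda>x. F2_rep D x $ _"] by (simp add: h normalized_F2_rep_def)
  then obtain b where b: "\<And>i. additive (b i)"
      "\<And>i x. F2_rep D x $ i = h x $ i + b i x + F2_rep D 0 $ i"
    by metis
  define a where "a x = (\<chi> i. b i x)" for x
  have a: "additive a"
    by (simp add: additive_def a_def vec_eq_iff additive.add[OF b(1)])
  have rep: "F2_rep D x = h x + a x + F2_rep D 0" for x
    by (simp only: vec_eq_iff b(2)[of x] vector_add_component a_def vec_lambda_beta) simp
  have h0: "h 0 = 0"
    by (simp add: h normalized_F2_rep_def remove_affine_terms_zero vec_eq_iff)
  note planar = planar_normalized[OF rds a rep]
  let ?P = "third_diff_zero h"
  have iff: "?P \<longleftrightarrow> (\<forall>x. additive (ast h x))"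
    by (rule third_diff_zero_iff_additive_ast)
  have 1: "comm_semifield UNIV (+) 0 (star h) \<longleftrightarrow> ?P"
    unfolding iff by (rule comm_semifield_star_iff[OF h0 planar])
  have 2: "comm_presemifield UNIV (+) 0 (ast h) \<longleftrightarrow> ?P"
    unfolding iff by (rule comm_presemifield_ast_iff[OF h0 planar])
  have 3: "(\<forall>x y z. h (x + y + z) + h (x + y) + h (x + z) + h (y + z) + h x + h y + h z = 0) \<longleftrightarrow> ?P"
    by (simp only: third_diff_zero_def)
  have "(\<forall>i. algebraic_degree (\<lambda>x. h x $ i) \<le> 2) \<longleftrightarrow> (\<forall>i. third_diff_zero (\<lambda>x. h x $ i))"
    by (simp add: algebraic_degree_le_2_iff h0)
  also have "\<dots> \<longleftrightarrow> ?P"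
    unfolding third_diff_zero_def vec_eq_iff by auto
  finally have 4: "(\<forall>i. algebraic_degree (\<lambda>x. h x $ i) \<le> 2) \<longleftrightarrow> ?P" .
  have 5: "Dembowski_Ostrom (normalized_field_rep \<xi> D) \<longleftrightarrow> ?P"
    by (rule Dembowski_Ostrom_normalized_field_rep_iff[OF card_field basis a rep h0])
  have iso: "isomorphic (coord_plane UNIV (+) (ast h)) (rds_plane D twice_Z4)"
    by (rule isomorphic_rds_plane[OF rds a rep h0])
  have 6: "comm_semifield_plane (rds_plane D twice_Z4) \<longleftrightarrow> ?P"
  proof
    assume "comm_semifield_plane (rds_plane D twice_Z4)"
    then show ?P
      unfolding iff using comm_semifield_plane_isomorphicD[OF h0 planar _ iso] by blast
  next
    assume ?P
    \<comment> \<open>Any injection into the points serves to relabel the semifield.\<close>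
    have "inj (\<lambda>x :: (bit, 'n) vec. Group_point (Z4_pair x 0))"
      by (simp add: inj_def Z4_pair_eq_iff)
    then obtain S :: "(4, 'n) vec rds_point set" and add z mul where S: "comm_semifield S add z mul"
      "isomorphic (coord_plane UNIV (+) (ast h)) (coord_plane S add mul)"
      using comm_semifield_plane_coord_plane[OF h0 planar] \<open>?P\<close> unfolding iff by metis
    moreover have "projective_plane (rds_plane D twice_Z4)"
      by (rule projective_plane_isomorphic[OF iso projective_plane_ast[OF h0 planar]])
    moreover have "isomorphic (rds_plane D twice_Z4) (coord_plane S add mul)"
      by (rule isomorphic_trans[OF isomorphic_sym[OF iso] S(2)])
    ultimately show "comm_semifield_plane (rds_plane D twice_Z4)"
      unfolding comm_semifield_plane_def by blast
  qed
  show ?thesis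
    unfolding all_equivalent_def by (simp only: 1 2 3 4 5 6) simp
qed

end
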